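(* Fix $\rho>0$ and a set $\mathcal X\subseteq\mathbb S_{++}^p$ of admissible precision matrices. For any $\widehat\Sigma\in\mathbb S_+^p$, the simplified distributionally robust estimation problem $$\mathcal J(\widehat\Sigma):=\inf_{X\in\mathcal X}\Big\{-\log\det X+\sup_{\mathbb Q\in\mathcal P_\rho^0}\mathbb E^{\mathbb Q}\big[\langle\xi\xi^\top,X\rangle\big]\Big\}$$ is equivalent to $$\mathcal J(\widehat\Sigma)=\inf_{X,\gamma}\Big\{-\log\det X+\gamma\big(\rho^2-\mathrm{Tr}[\widehat\Sigma]\big)+\gamma^2\big\langle(\gamma I-X)^{-1},\widehat\Sigma\big\rangle\;:\;\gamma I\succ X\succ0,\;X\in\mathcal X\Big\}.$$ Moreover, the optimal value function $\mathcal J(\widehat\Sigma)$ is continuous in $\widehat\Sigma\in\mathbb S_+^p$.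
   Context: $\mathbb S^p$ is the space of symmetric real $p\times p$ matrices, $\mathbb S_+^p$ ($\mathbb S_{++}^p$) the cone of positive semidefinite (positive definite) ones; $A\succeq B$ ($A\succ B$) means $A-B\in\mathbb S_+^p$ ($A-B\in\mathbb S_{++}^p$); $\langle A,B\rangle=\mathrm{Tr}[A^\top B]$. The decision variables are $\gamma\in\mathbb R$ and $X\in\mathbb S^p$; the infimum over an empty set is $+\infty$. $\mathcal N(0,\Sigma)$ denotes the (possibly degenerate) normal distribution on $\mathbb R^p$ with mean $0$ and covariance matrix $\Sigma\in\mathbb S_+^p$, and $\mathcal N_0^p$ is the family of all such zero-mean normal distributions. The type-2 Wasserstein distance between distributions $\mathbb P_1,\mathbb P_2$ on $\mathbb R^p$ with finite second moments is $\mathbb W(\mathbb P_1,\mathbb P_2)=\inf_\Pi\big(\int\|\xi_1-\xi_2\|^2\,\Pi(d\xi_1,d\xi_2)\big)^{1/2}$, where $\Pi$ ranges over all joint distributions with marginals $\mathbb P_1$ and $\mathbb P_2$ and $\|\cdot\|$ is the Euclidean norm. The ambiguity set is $\mathcal P_\rho^0=\{\mathbb Q\in\mathcal N_0^p:\mathbb W(\mathbb Q,\mathcal N(0,\widehat\Sigma))\le\rho\}$. Under $\mathbb E^{\mathbb Q}$, the random vector $\xi\in\mathbb R^p$ has distribution $\mathbb Q$. *)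

theory Defs
  imports "HOL-Probability.Probability"
begin

text \<open>The space of real \<open>p \<times> p\<close> matrices is \<^typ>\<open>real^'n^'n\<close> with \<open>p = CARD('n)\<close>.\<close>

definition psd :: "real^'n^'n \<Rightarrow> bool" where
  "psd A \<longleftrightarrow> transpose A = A \<and> (\<forall>x. 0 \<le> x \<bullet> (A *v x))"

definition posdef :: "real^'n^'n \<Rightarrow> bool" where
  "posdef A \<longleftrightarrow> transpose A = A \<and> (\<forall>x. x \<noteq> 0 \<longrightarrow> 0 < x \<bullet> (A *v x))"

definition mat_inner :: "real^'n^'n \<Rightarrow> real^'n^'n \<Rightarrow> real" where
  "mat_inner A B = trace (transpose A ** B)"

text \<open>\<open>\<xi> \<xi>\<^sup>T\<close>\<close>

definition outer :: "real^'n \<Rightarrow> real^'n^'n" where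
  "outer \<xi> = (\<chi> i j. \<xi> $ i * \<xi> $ j)"

definition std_mvnormal :: "(real^'n) measure" where
  "std_mvnormal = density lborel (\<lambda>x. ennreal (\<Prod>i\<in>UNIV. std_normal_density (x $ i)))"

text \<open>\<open>N(0, S)\<close>, possibly degenerate, is the law of \<open>B z\<close> for a standard normal vector \<open>z\<close>,
  where \<open>B B\<^sup>T = S\<close>. For positive semidefinite \<open>S\<close> such a \<open>B\<close> exists, and the law
  does not depend on which one is chosen. The definition is meaningful for positive
  semidefinite \<open>S\<close> only.\<close>

definition mvnormal :: "real^'n^'n \<Rightarrow> (real^'n) measure" where
  "mvnormal S = distr std_mvnormal borel (\<lambda>z. (SOME B :: real^'n^'n. B ** transpose B = S) *v z)"

definition zero_mean_normals :: "(real^'n) measure set" where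
  "zero_mean_normals = {mvnormal S |S. psd S}"

definition couplings ::
    "(real^'n) measure \<Rightarrow> (real^'n) measure \<Rightarrow> ((real^'n) \<times> (real^'n)) measure set" where
  "couplings P Q = {M. prob_space M \<and> sets M = sets (borel \<Otimes>\<^sub>M borel)
     \<and> distr M borel fst = P \<and> distr M borel snd = Q}"

text \<open>Intended for distributions with finite second moments: then the set of couplings is
  nonempty and the squared distance is integrable under each of them, so neither the
  Bochner integral nor the real infimum takes a default value.\<close>

definition wasserstein2 :: "(real^'n) measure \<Rightarrow> (real^'n) measure \<Rightarrow> real" where
  "wasserstein2 P Q =
     (INF M\<in>couplings P Q. sqrt (\<integral>z. (norm (fst z - snd z))\<^sup>2 \<partial>M))"

definition ambiguity_set :: "real \<Rightarrow> real^'n^'n \<Rightarrow> (real^'n) measure set" where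
  "ambiguity_set \<rho> S = {Q \<in> zero_mean_normals. wasserstein2 Q (mvnormal S) \<le> \<rho>}"

text \<open>Optimal values are extended reals, so that \<open>INF\<close> over the empty set is \<open>\<infinity>\<close>.\<close>

definition dro_value :: "real \<Rightarrow> (real^'n^'n) set \<Rightarrow> real^'n^'n \<Rightarrow> ereal" where
  "dro_value \<rho> \<X> S =
     (INF X\<in>\<X>. ereal (- ln (det X)) +
        (SUP Q\<in>ambiguity_set \<rho> S. ereal (\<integral>\<xi>. mat_inner (outer \<xi>) X \<partial>Q)))"

end

theory Submission
  imports Defs
begin

text \<open>
  A zero-mean normal law with covariance \<open>B B\<^sup>T\<close> is the law of \<open>B z\<close> for a standard normal
  vector \<open>z\<close>. Its expectation of \<open>\<langle>\<xi> \<xi>\<^sup>T, X\<rangle>\<close> is \<open>Tr(B\<^sup>T X B)\<close>, and the laws of \<open>C z\<close> and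
  \<open>B z\<close> are at Wasserstein distance at most the Frobenius distance of \<open>C\<close> and \<open>B\<close>. The inner
  supremum therefore turns into the maximum of the convex form \<open>Tr(C\<^sup>T X C)\<close> over a Frobenius
  ball around a factor \<open>B\<close> of \<open>S\<close> (\<open>worst_case\<close>), once two inequalities are known.

  The maximum bounds the supremum by weak duality. For \<open>\<gamma> I \<succ> X\<close>, completing the square gives
  \<open>\<xi> \<bullet> X \<xi> - \<gamma> \<parallel>\<xi> - \<zeta>\<parallel>\<^sup>2 \<le> \<zeta> \<bullet> (\<gamma>\<^sup>2 (\<gamma> I - X)\<^sup>-\<^sup>1 - \<gamma> I) \<zeta>\<close>, and integrating this
  against any coupling bounds the expectation by the dual objective at \<open>\<gamma>\<close>
  (\<open>ambiguous_expectation_le_dual\<close>). There is no duality gap: the maximum of a convex quadratic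
  form over a ball is a trust region problem, whose multiplier dominates the form
  (\<open>trust_region_multiplier\<close>), so the dual objective comes arbitrarily close to the maximum
  (\<open>dual_bound_approx\<close>).

  The supremum reaches the maximum because factors \<open>C\<close> in the ball give laws in the
  ambiguity set. Invertible \<open>C\<close> are enough by density, and for these the law of \<open>C z\<close> is
  determined by \<open>C C\<^sup>T\<close> through rotation invariance of the standard normal law.

  For continuity, a change of the centre \<open>B\<close> by \<open>\<delta>\<close> changes the maximum by a factor of at
  most \<open>(1 + \<delta> / \<rho>)\<^sup>2\<close> (\<open>worst_case_perturb\<close>), whatever \<open>X\<close> is. Covariances \<open>S\<close> and \<open>S'\<close> at
  distance \<open>d\<close> satisfy \<open>S \<preceq> S' + d I\<close>, the maximum is monotone in the covariance by duality,
  and \<open>S'\<close> and \<open>S' + d I\<close> have factors at distance at most \<open>\<surd>(p d)\<close>. This bounds the maxima for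
  \<open>S\<close> and \<open>S'\<close> by multiples of each other, with ratio tending to \<open>1\<close> uniformly in \<open>X\<close>. Since
  \<open>ln det X\<close> is at most half the maximum plus a constant (\<open>ln_det_le_worst_case\<close>), the same
  holds for the objective shifted by that constant and for its infimum over \<open>X\<close>.
\<close>

section \<open>Quadratic forms of matrices\<close>

lemma mat_inner_eq_inner: "mat_inner A B = A \<bullet> B"
  unfolding mat_inner_def trace_def transpose_def matrix_matrix_mult_def inner_vec_def
  by (simp, subst sum.swap) simp

lemma inner_outer: "outer x \<bullet> A = x \<bullet> (A *v x)"
  by (simp add: outer_def inner_vec_def matrix_vector_mult_def sum_distrib_left mult_ac)

lemma inner_outer_outer: "outer x \<bullet> outer y = (x \<bullet> y)\<^sup>2"
  by (simp add: outer_def inner_vec_def power2_eq_square sum_product mult_ac)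

lemma norm_outer: "norm (outer x) = (norm x)\<^sup>2"
  by (simp add: norm_eq_sqrt_inner inner_outer_outer)

text \<open>Cauchy--Schwarz for the Frobenius inner product, because
  \<open>x \<bullet> A x\<close> is the inner product of \<open>A\<close> with \<open>x x\<^sup>T\<close>.\<close>

lemma quadratic_form_le_norm:
  fixes A :: "real^'n^'n"
  shows "\<bar>x \<bullet> (A *v x)\<bar> \<le> norm A * (x \<bullet> x)"
  using Cauchy_Schwarz_ineq2[of "outer x" A]
  by (simp add: inner_outer norm_outer power2_norm_eq_inner mult.commute)

lemma inner_matrix_columns:
  fixes A B :: "real^'m^'n"
  shows "A \<bullet> B = (\<Sum>j\<in>UNIV. column j A \<bullet> column j B)"
  unfolding inner_vec_def column_def by (simp, subst sum.swap) simp

lemma column_matrix_mult: "column j (X ** B) = X *v column j B"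
  by (simp add: column_def matrix_matrix_mult_def matrix_vector_mult_def vec_eq_iff)

text \<open>The form \<open>C \<mapsto> Tr(C\<^sup>T X C)\<close> splits over the columns of \<open>C\<close>. This carries every
  inequality between quadratic forms on vectors over to matrices.\<close>

lemma matrix_form_columns:
  fixes X :: "real^'n^'n"
  shows "C \<bullet> (X ** C) = (\<Sum>j\<in>UNIV. column j C \<bullet> (X *v column j C))"
  by (simp add: inner_matrix_columns column_matrix_mult)

lemma inner_gram:
  fixes A :: "real^'n^'n" and B :: "real^'m^'n"
  shows "A \<bullet> (B ** transpose B) = B \<bullet> (A ** B)"
proof -
  have "A \<bullet> (B ** transpose B) = (\<Sum>i\<in>UNIV. \<Sum>j\<in>UNIV. \<Sum>k\<in>UNIV. A$i$j * (B$i$k * B$j$k))"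
    by (simp add: inner_vec_def matrix_matrix_mult_def transpose_def sum_distrib_left)
  also have "\<dots> = (\<Sum>i\<in>UNIV. \<Sum>k\<in>UNIV. \<Sum>j\<in>UNIV. A$i$j * (B$i$k * B$j$k))"
    by (intro sum.cong refl sum.swap)
  also have "\<dots> = B \<bullet> (A ** B)"
    by (simp add: inner_vec_def matrix_matrix_mult_def sum_distrib_left mult_ac)
  finally show ?thesis .
qed

lemma trace_gram: "trace (B ** transpose B) = B \<bullet> (B :: real^'m^'n)"
  by (simp add: trace_def inner_vec_def matrix_matrix_mult_def transpose_def)

lemma inner_symmetric_matrix:
  fixes A :: "real^'n^'n"
  assumes "transpose A = A"
  shows "(A *v x) \<bullet> y = x \<bullet> (A *v y)"
  by (metis assms dot_lmul_matrix transpose_matrix_vector)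

lemma mat_mult_vec: "mat c *v x = c *\<^sub>R (x :: real^'n)"
  by (simp add: matrix_vector_mult_def mat_def vec_eq_iff if_distrib[of "\<lambda>u. u * _"] cong: if_cong)

lemma matrix_vector_mult_sum_left:
  "(\<Sum>i\<in>I. A i) *v x = (\<Sum>i\<in>I. A i *v (x :: real^'n))"
  by (induction I rule: infinite_finite_induct) (auto simp: matrix_vector_mult_add_rdistrib)

lemma transpose_diff: "transpose (A - B :: real^'n^'m) = transpose A - transpose B"
  by (simp add: transpose_def vec_eq_iff)

lemma transpose_add: "transpose (A + B :: real^'n^'m) = transpose A + transpose B"
  by (simp add: transpose_def vec_eq_iff)

lemma psd_gram: "psd (B ** transpose B :: real^'n^'n)"
  unfolding psd_def
proof (intro conjI allI)
  fix x :: "real^'n"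
  have "x \<bullet> (B ** transpose B *v x) = (transpose B *v x) \<bullet> (transpose B *v x)"
    by (metis dot_lmul_matrix matrix_vector_mul_assoc transpose_matrix_vector)
  then show "0 \<le> x \<bullet> (B ** transpose B *v x)" by (simp only: inner_ge_zero)
qed (simp add: matrix_transpose_mul)

lemma posdef_imp_psd: "posdef A \<Longrightarrow> psd A"
  by (metis inner_zero_left less_eq_real_def posdef_def psd_def)

lemma posdef_invertible:
  assumes "posdef (A :: real^'n^'n)"
  shows "invertible A"
proof -
  have "\<And>x. A *v x = 0 \<Longrightarrow> x = 0"
    using assms unfolding posdef_def by (metis inner_zero_right less_irrefl)
  then show ?thesis
    by (metis invertible_left_inverse matrix_left_invertible_ker)
qed

lemma invertible_matrix_inv:
  fixes A :: "real^'n^'n"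
  assumes "invertible A"
  shows "A ** matrix_inv A = mat 1" "matrix_inv A ** A = mat 1"
  using someI_ex[OF assms[unfolded invertible_def]] by (auto simp: matrix_inv_def)

section \<open>Diagonalisation and square roots\<close>

text \<open>A maximiser of the Rayleigh quotient on the unit sphere of an invariant subspace is an
  eigenvector.\<close>

lemma self_adjoint_eigenvector:
  fixes f :: "'a::euclidean_space \<Rightarrow> 'a"
  assumes lin: "linear f" and sym: "\<And>x y. f x \<bullet> y = x \<bullet> f y"
    and W: "subspace W" and inv: "\<And>x. x \<in> W \<Longrightarrow> f x \<in> W" and "w \<in> W" "w \<noteq> 0"
  obtains v l where "v \<in> W" "norm v = 1" "f v = l *\<^sub>R v"
proof -
  let ?S = "sphere 0 1 \<inter> W"
  have bl: "bounded_linear f" using lin by (simp add: linear_conv_bounded_linear)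
  have "compact ?S" using W closed_subspace by (intro compact_Int_closed) auto
  moreover have "(1 / norm w) *\<^sub>R w \<in> ?S"
    using assms by (auto intro!: subspace_scale[OF W])
  hence "?S \<noteq> {}" by blast
  moreover have "continuous_on ?S (\<lambda>x. x \<bullet> f x)"
    by (intro continuous_intros linear_continuous_on bl)
  ultimately obtain v where v: "v \<in> ?S" and max: "\<And>y. y \<in> ?S \<Longrightarrow> y \<bullet> f y \<le> v \<bullet> f v"
    by (metis (lifting) continuous_attains_sup)
  define l where "l = v \<bullet> f v"
  have vv: "v \<bullet> v = 1" using v by (simp add: dot_square_norm)
  have rayleigh: "y \<bullet> f y \<le> l * (y \<bullet> y)" if y: "y \<in> W" for y
  proof (cases "y = 0")
    case True then show ?thesis using linear_0[OF lin] by simp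
  next
    case False
    have "(1 / norm y) *\<^sub>R y \<in> ?S" using False y by (auto intro!: subspace_scale[OF W])
    from max[OF this] show ?thesis using False
      by (simp add: l_def linear_cmul[OF lin] divide_simps power2_eq_square flip: power2_norm_eq_inner)
  qed
  define u where "u = f v - l *\<^sub>R v"
  have uW: "u \<in> W" unfolding u_def using v inv W by (auto intro!: subspace_diff subspace_scale)
  have uv: "u \<bullet> v = 0" by (simp add: u_def l_def inner_diff_left vv inner_commute[of "f v" v])
  have fvu: "f v \<bullet> u = u \<bullet> u"
    using uv by (simp add: u_def inner_diff_left inner_diff_right inner_commute)
  \<comment> \<open>Moving along the residual \<open>u\<close> raises the Rayleigh quotient to first order
    unless the residual vanishes.\<close>
  have ineq: "2 * t * (u \<bullet> u) \<le> t\<^sup>2 * (l * (u \<bullet> u) - u \<bullet> f u)" for t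
  proof -
    have "v + t *\<^sub>R u \<in> W" using v uW W by (auto intro!: subspace_add subspace_scale)
    from rayleigh[OF this]
    have "l + 2 * t * (f v \<bullet> u) + t\<^sup>2 * (u \<bullet> f u) \<le> l * (1 + t\<^sup>2 * (u \<bullet> u))"
      using uv vv sym[of v u] sym[of u v]
      by (simp add: linear_add[OF lin] linear_cmul[OF lin] inner_add_left inner_add_right
          inner_commute power2_eq_square l_def algebra_simps)
    then show ?thesis by (simp add: fvu algebra_simps)
  qed
  have "u \<bullet> u \<le> 0"
  proof (rule ccontr)
    assume "\<not> u \<bullet> u \<le> 0"
    then have pos: "u \<bullet> u > 0" by linarith
    define a where "a = l * (u \<bullet> u) - u \<bullet> f u"
    define t where "t = (u \<bullet> u) / (\<bar>a\<bar> + 1)"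
    have tpos: "t > 0" using pos by (simp add: t_def)
    have "t * (2 * (u \<bullet> u)) \<le> t * (t * a)" using ineq[of t] by (simp add: a_def power2_eq_square mult_ac)
    then have "2 * (u \<bullet> u) \<le> t * a" using tpos by simp
    also have "\<dots> \<le> t * (\<bar>a\<bar> + 1)" using tpos by (intro mult_left_mono) auto
    also have "\<dots> = u \<bullet> u" by (simp add: t_def)
    finally show False using pos by simp
  qed
  then have "u = 0" using inner_gt_zero_iff[of u] by (meson not_less)
  then have "f v = l *\<^sub>R v" by (simp add: u_def)
  with v that[of v l] show ?thesis by auto
qed

text \<open>The orthogonal complement of a set of eigenvectors is invariant, so an orthonormal set of
  eigenvectors of greatest cardinality must span the space.\<close>

lemma self_adjoint_eigenbasis:
  fixes f :: "'a::euclidean_space \<Rightarrow> 'a"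
  assumes lin: "linear f" and sym: "\<And>x y. f x \<bullet> y = x \<bullet> f y"
  obtains V l where "pairwise orthogonal V" "\<And>v. v \<in> V \<Longrightarrow> norm v = 1"
    "\<And>v. v \<in> V \<Longrightarrow> f v = l v *\<^sub>R v" "span V = UNIV" "finite V" "card V \<le> DIM('a)"
proof -
  define P where "P V \<longleftrightarrow> pairwise orthogonal V \<and> (\<forall>v\<in>V. norm v = 1 \<and> (\<exists>c. f v = c *\<^sub>R v))" for V
  have card: "finite V \<and> card V \<le> DIM('a)" if "P V" for V
  proof -
    have "independent V"
      using that unfolding P_def by (intro pairwise_orthogonal_independent) force+
    then show ?thesis using independent_bound by blast
  qed
  have "P {}" by (simp add: P_def pairwise_def)
  then obtain V where PV: "P V" and max: "\<And>V'. P V' \<Longrightarrow> card V' \<le> card V"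
    using ex_has_greatest_nat[of P "{}" card "Suc DIM('a)"] card by (metis le_imp_less_Suc)
  have fin: "finite V" using card PV by blast
  have span: "span V = UNIV"
  proof (rule ccontr)
    assume "span V \<noteq> UNIV"
    then have "dim V < DIM('a)"
      by (metis dim_eq_full dim_subset_UNIV le_neq_implies_less)
    then obtain w where w: "w \<noteq> 0" "\<And>y. y \<in> span V \<Longrightarrow> orthogonal w y"
      using orthogonal_to_subspace_exists by metis
    define W where "W = {x. \<forall>v\<in>V. v \<bullet> x = 0}"
    have W: "subspace W" by (auto simp: W_def subspace_def inner_right_distrib)
    have inv: "f x \<in> W" if "x \<in> W" for x
    proof -
      have "v \<bullet> f x = 0" if "v \<in> V" for v
      proof -
        obtain c where "f v = c *\<^sub>R v" using PV \<open>v \<in> V\<close> unfolding P_def by blast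
        then have "v \<bullet> f x = c * (v \<bullet> x)" using sym[of v x] by simp
        then show ?thesis using \<open>x \<in> W\<close> that by (simp add: W_def)
      qed
      then show ?thesis by (simp add: W_def)
    qed
    have "w \<in> W" using w span_base by (auto simp: W_def orthogonal_def inner_commute)
    then obtain v c where v: "v \<in> W" "norm v = 1" "f v = c *\<^sub>R v"
      using self_adjoint_eigenvector[OF lin sym W inv _ w(1)] by metis
    have "v \<notin> V" using v by (auto simp: W_def)
    moreover have "P (insert v V)"
      using PV v unfolding P_def W_def
      by (auto simp: pairwise_insert orthogonal_def inner_commute)
    ultimately show False using max[of "insert v V"] fin by simp
  qed
  from PV obtain l where "\<And>v. v \<in> V \<Longrightarrow> f v = l v *\<^sub>R v" unfolding P_def by metis
  with PV span card[OF PV] that show ?thesis unfolding P_def by blast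
qed

lemma sqrt_diff_square_le:
  assumes "0 \<le> a" "0 \<le> (d::real)"
  shows "(sqrt (a + d) - sqrt a)\<^sup>2 \<le> d"
proof -
  have "sqrt a * sqrt a \<le> sqrt (a + d) * sqrt a"
    using assms by (intro mult_right_mono) auto
  then show ?thesis using assms by (simp add: power2_diff)
qed

text \<open>Both factors are functions of \<open>S\<close> in one eigenbasis, \<open>\<surd>S\<close> and \<open>\<surd>(S + d I)\<close>, so their
  distance is controlled eigenvalue by eigenvalue.\<close>

lemma psd_shifted_factors:
  fixes S :: "real^'n^'n" and d :: real
  assumes "psd S" "0 \<le> d"
  obtains B B' :: "real^'n^'n" where "B ** transpose B = S" "B' ** transpose B' = S + mat d"
    "(norm (B' - B))\<^sup>2 \<le> CARD('n) * d"
proof -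
  have sym: "transpose S = S" using assms by (simp add: psd_def)
  obtain V l where V: "pairwise orthogonal V" "\<And>v. v \<in> V \<Longrightarrow> norm v = 1"
    and eig: "\<And>v. v \<in> V \<Longrightarrow> S *v v = l v *\<^sub>R v" and span: "span V = UNIV"
    and fin: "finite V" and card: "card V \<le> CARD('n)"
    using self_adjoint_eigenbasis[of "(*v) S"] inner_symmetric_matrix[OF sym]
    by (metis DIM_cart DIM_real mult.right_neutral matrix_vector_mul_linear)
  have ip: "v \<bullet> w = (if v = w then 1 else 0)" if "v \<in> V" "w \<in> V" for v w
    using V that by (auto simp: pairwise_def orthogonal_def dot_square_norm)
  have l: "0 \<le> l v" if "v \<in> V" for v
    using assms(1) eig[OF that] ip[OF that that] by (metis inner_scaleR_right mult.right_neutral psd_def)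
  define G :: "(_ \<Rightarrow> real) \<Rightarrow> real^'n^'n" where "G h = (\<Sum>v\<in>V. h v *\<^sub>R outer v)" for h
  have G_v: "G h *v v = h v *\<^sub>R v" if "v \<in> V" for h v
  proof -
    have "outer w *v v = (w \<bullet> v) *\<^sub>R w" for w :: "real^'n"
      by (simp add: outer_def matrix_vector_mult_def vec_eq_iff inner_vec_def sum_distrib_left mult_ac)
    then have "G h *v v = (\<Sum>w\<in>V. (h w * (w \<bullet> v)) *\<^sub>R w)"
      unfolding G_def
      by (simp add: matrix_vector_mult_sum_left flip: scaleR_matrix_vector_assoc)
    also have "\<dots> = (\<Sum>w\<in>V. if w = v then h v *\<^sub>R v else 0)"
      using ip that by (intro sum.cong) auto
    finally show ?thesis using fin that by simp
  qed
  have G_transpose: "transpose (G h) = G h" for h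
    by (simp add: G_def outer_def transpose_def vec_eq_iff mult.commute)
  have eqI: "M = N" if "\<And>v. v \<in> V \<Longrightarrow> M *v v = N *v v" for M N :: "real^'n^'n"
  proof -
    have "M *v x = N *v x" for x
      by (rule linear_eq_on_span[of "(*v) M" "(*v) N" V])
        (use that span in auto)
    then show ?thesis by (simp add: matrix_eq)
  qed
  have "G (\<lambda>v. sqrt (l v)) ** transpose (G (\<lambda>v. sqrt (l v))) = S"
    by (rule eqI) (use l eig in \<open>simp add: G_transpose G_v matrix_vector_mult_scaleR
      flip: matrix_vector_mul_assoc\<close>)
  moreover have "G (\<lambda>v. sqrt (l v + d)) ** transpose (G (\<lambda>v. sqrt (l v + d))) = S + mat d"
    by (rule eqI) (use l eig assms(2) in \<open>simp add: G_transpose G_v matrix_vector_mult_scaleR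
      matrix_vector_mult_add_rdistrib mat_mult_vec scaleR_left_distrib
      flip: matrix_vector_mul_assoc\<close>)
  moreover have "(norm (G (\<lambda>v. sqrt (l v + d)) - G (\<lambda>v. sqrt (l v))))\<^sup>2 \<le> CARD('n) * d"
  proof -
    let ?h = "\<lambda>v. sqrt (l v + d) - sqrt (l v)"
    have "G (\<lambda>v. sqrt (l v + d)) - G (\<lambda>v. sqrt (l v)) = G ?h"
      by (simp add: G_def sum_subtractf scaleR_left_diff_distrib)
    moreover have "(norm (G ?h))\<^sup>2 = (\<Sum>v\<in>V. \<Sum>w\<in>V. ?h v * ?h w * (v \<bullet> w)\<^sup>2)"
      by (simp add: power2_norm_eq_inner G_def inner_sum_left inner_sum_right inner_outer_outer
          sum_distrib_left inner_commute mult_ac)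
    moreover have "\<dots> = (\<Sum>v\<in>V. \<Sum>w\<in>V. if v = w then (?h v)\<^sup>2 else 0)"
      using ip by (intro sum.cong) (auto simp: power2_eq_square)
    moreover have "\<dots> = (\<Sum>v\<in>V. (?h v)\<^sup>2)" using fin by simp
    moreover have "\<dots> \<le> (\<Sum>v\<in>V. d)"
      by (intro sum_mono sqrt_diff_square_le l assms(2))
    moreover have "\<dots> \<le> CARD('n) * d" using card assms(2) by (simp add: mult_right_mono)
    ultimately show ?thesis by simp
  qed
  ultimately show ?thesis by (rule that)
qed

lemma psd_factor:
  fixes S :: "real^'n^'n"
  assumes "psd S"
  obtains B :: "real^'n^'n" where "B ** transpose B = S"
  using psd_shifted_factors[OF assms, of 0] by auto

section \<open>Determinants and invertible matrices\<close>

lemma det_posdef_pos: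
  fixes X :: "real^'n^'n"
  assumes "posdef X"
  shows "0 < det X"
proof -
  obtain B :: "real^'n^'n" where "B ** transpose B = X"
    using psd_factor posdef_imp_psd[OF assms] by blast
  then have "det X = (det B)\<^sup>2" by (metis det_mul det_transpose power2_eq_square)
  moreover have "det X \<noteq> 0" using posdef_invertible[OF assms] by (simp add: invertible_det_nz)
  ultimately show ?thesis by simp
qed

text \<open>The Leibniz formula has \<open>p!\<close> terms. The bound is crude, but only its polynomial growth
  in \<open>m\<close> matters later.\<close>

lemma det_le_entries:
  fixes A :: "real^'n^'n"
  assumes "\<And>i j. \<bar>A $ i $ j\<bar> \<le> m"
  shows "det A \<le> fact CARD('n) * m ^ CARD('n)"
proof -
  have "det A \<le> (\<Sum>p | p permutes (UNIV::'n set). m ^ CARD('n))"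
    unfolding det_def
  proof (rule sum_mono)
    fix p :: "'n \<Rightarrow> 'n"
    have "of_int (sign p) * (\<Prod>i\<in>UNIV. A $ i $ p i) \<le> \<bar>of_int (sign p) * (\<Prod>i\<in>UNIV. A $ i $ p i)\<bar>"
      by simp
    also have "\<dots> = (\<Prod>i\<in>UNIV. \<bar>A $ i $ p i\<bar>)" by (simp add: abs_mult sign_def abs_prod)
    also have "\<dots> \<le> (\<Prod>i\<in>(UNIV::'n set). m)" by (rule prod_mono) (simp add: assms)
    finally show "of_int (sign p) * (\<Prod>i\<in>UNIV. A $ i $ p i) \<le> m ^ CARD('n)" by simp
  qed
  then show ?thesis by (simp add: card_permutations[OF refl])
qed

text \<open>The function \<open>t \<mapsto> det (C + t I)\<close> is a polynomial. It is not zero, since \<open>C + t I\<close> has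
  trivial kernel for \<open>t\<close> beyond the norm of \<open>C\<close>, so arbitrarily small \<open>t > 0\<close> avoid its roots.\<close>

lemma open_contains_invertible:
  fixes C :: "real^'n^'n"
  assumes "open U" "C \<in> U"
  obtains D where "D \<in> U" "invertible D"
proof -
  define p where "p = (\<Sum>q | q permutes (UNIV::'n set).
     [:of_int (sign q):] * (\<Prod>i\<in>UNIV. [:C $ i $ q i, if i = q i then 1 else 0:]))"
  have p: "poly p t = det (C + t *\<^sub>R mat 1)" for t
    unfolding p_def det_def poly_sum poly_mult poly_prod
    by (intro sum.cong refl arg_cong2[of _ _ _ _ "(*)"] prod.cong) (auto simp: mat_def)
  have "p \<noteq> 0"
  proof
    assume "p = 0"
    then have "\<not> invertible (C + (norm C + 1) *\<^sub>R mat 1)"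
      using p by (metis invertible_det_nz poly_0)
    then obtain x where x: "x \<noteq> 0" "(C + (norm C + 1) *\<^sub>R mat 1) *v x = 0"
      by (metis invertible_left_inverse matrix_left_invertible_ker)
    then have "x \<bullet> (C *v x) + (norm C + 1) * (x \<bullet> x) = 0"
      by (metis inner_add_right inner_scaleR_right inner_zero_right matrix_vector_mul_lid
          matrix_vector_mult_add_rdistrib scaleR_matrix_vector_assoc)
    moreover have "x \<bullet> x > 0" using x by simp
    ultimately show False using quadratic_form_le_norm[of x C] unfolding distrib_right by linarith
  qed
  then have fin: "finite {t. poly p t = 0}" by (rule poly_roots_finite)
  have "((\<lambda>t. C + t *\<^sub>R mat 1) \<longlongrightarrow> C + 0 *\<^sub>R mat 1) (at_right 0)"
    by (intro tendsto_intros)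
  then have "\<forall>\<^sub>F t in at_right 0. C + t *\<^sub>R mat 1 \<in> U"
    using assms by (intro topological_tendstoD) auto
  then obtain e where e: "e > 0" "\<And>t. 0 < t \<Longrightarrow> t < e \<Longrightarrow> C + t *\<^sub>R mat 1 \<in> U"
    by (auto simp: eventually_at_right_field)
  have "infinite {0<..<e}" using e by (simp add: infinite_Ioo)
  then obtain t where "t \<in> {0<..<e}" "poly p t \<noteq> 0"
    using fin by (metis (mono_tags, lifting) finite_subset mem_Collect_eq subsetI)
  with e p that[of "C + t *\<^sub>R mat 1"] show ?thesis by (simp add: invertible_det_nz)
qed

section \<open>Rotation invariance of the standard normal law\<close>

text \<open>For Borel sets \<open>A\<close> and \<open>B\<close>, integrate the product of the indicators of \<open>A\<close> at \<open>U x\<close> and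
  \<open>B\<close> at \<open>y + U x\<close> in both orders. Invariance under translation and reflection yields
  \<open>\<lambda>(U\<^sup>-\<^sup>1 A) \<lambda>(B) = \<lambda>(A) \<lambda>(U\<^sup>-\<^sup>1 B)\<close>, where \<open>\<lambda>\<close> is Lebesgue measure. Taking for \<open>B\<close> the
  unit ball, which \<open>U\<close> preserves, gives the claim.\<close>

lemma lborel_orthogonal_invariant:
  fixes U :: "'a::euclidean_space \<Rightarrow> 'a"
  assumes "orthogonal_transformation U"
  shows "distr lborel borel U = lborel"
proof -
  have lin: "linear U" and norm: "\<And>x. norm (U x) = norm x"
    using assms by (auto simp: orthogonal_transformation)
  have bl: "bounded_linear U" using lin by (simp add: linear_conv_bounded_linear)
  have [measurable]: "U \<in> borel_measurable borel"
    by (intro borel_measurable_continuous_onI linear_continuous_on bl)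
  define V where "V = inv U"
  have V: "U (V y) = y" for y
    unfolding V_def using orthogonal_transformation_surj[OF assms] by (rule surj_f_inv_f)
  have shift: "(\<integral>\<^sup>+x. f (x + c) \<partial>lborel) = (\<integral>\<^sup>+x. f x \<partial>lborel)"
    if [measurable]: "f \<in> borel_measurable borel" for f :: "'a \<Rightarrow> ennreal" and c
  proof -
    have "(\<integral>\<^sup>+x. f x \<partial>lborel) = (\<integral>\<^sup>+x. f x \<partial>distr lborel borel ((+) c))"
      by (simp add: lborel_distr_plus)
    also have "\<dots> = (\<integral>\<^sup>+x. f (x + c) \<partial>lborel)"
      by (simp add: nn_integral_distr add.commute)
    finally show ?thesis by simp
  qed
  have reflect: "(\<integral>\<^sup>+x. f (c - x) \<partial>lborel) = (\<integral>\<^sup>+x. f x \<partial>lborel)"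
    if [measurable]: "f \<in> borel_measurable borel" for f :: "'a \<Rightarrow> ennreal" and c
  proof -
    have "(\<integral>\<^sup>+x. f x \<partial>lborel)
      = (\<integral>\<^sup>+x. f x \<partial>density (distr lborel borel (\<lambda>x. c + (-1) *\<^sub>R x)) (\<lambda>_. ennreal (\<bar>-1\<bar> ^ DIM('a))))"
      by (subst lborel_affine[of "-1" c]) simp_all
    also have "\<dots> = (\<integral>\<^sup>+x. f (c - x) \<partial>lborel)"
      by (simp add: density_1 nn_integral_distr)
    finally show ?thesis by simp
  qed
  have swap: "emeasure lborel (U -` A) * emeasure lborel B = emeasure lborel A * emeasure lborel (U -` B)"
    if [measurable]: "A \<in> sets borel" "B \<in> sets borel" for A B :: "'a set"
  proof -
    have pre: "U -` S \<in> sets borel" if "S \<in> sets borel" for S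
      using measurable_sets_borel[OF \<open>U \<in> borel_measurable borel\<close> that] .
    have ind: "(\<integral>\<^sup>+x. indicator S (U x) \<partial>lborel) = emeasure lborel (U -` S)" if "S \<in> sets borel" for S
      using pre[OF that] by (simp flip: nn_integral_indicator add: indicator_def)
    have "emeasure lborel (U -` A) * emeasure lborel B
      = (\<integral>\<^sup>+x. indicator A (U x) * emeasure lborel B \<partial>lborel)"
      by (simp add: nn_integral_multc ind)
    also have "\<dots> = (\<integral>\<^sup>+x. indicator A (U x) * (\<integral>\<^sup>+y. indicator B (y + U x) \<partial>lborel) \<partial>lborel)"
      by (simp add: shift)
    also have "\<dots> = (\<integral>\<^sup>+x. \<integral>\<^sup>+y. indicator A (U x) * indicator B (y + U x) \<partial>lborel \<partial>lborel)"
      by (simp add: nn_integral_cmult)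
    also have "\<dots> = (\<integral>\<^sup>+y. \<integral>\<^sup>+x. indicator A (U x) * indicator B (y + U x) \<partial>lborel \<partial>lborel)"
      by (rule lborel_pair.Fubini') measurable
    also have "\<dots> = (\<integral>\<^sup>+y. \<integral>\<^sup>+x. indicator A (U x - y) * indicator B (U x) \<partial>lborel \<partial>lborel)"
    proof (rule nn_integral_cong)
      fix y
      show "(\<integral>\<^sup>+x. indicator A (U x) * indicator B (y + U x) \<partial>lborel)
        = (\<integral>\<^sup>+x. indicator A (U x - y) * indicator B (U x) \<partial>(lborel :: 'a measure))"
        using shift[of "\<lambda>x. indicator A (U x - y) * indicator B (U x)" "V y"]
        by (simp add: linear_add[OF lin] V add.commute)
    qed
    also have "\<dots> = (\<integral>\<^sup>+x. \<integral>\<^sup>+y. indicator A (U x - y) * indicator B (U x) \<partial>lborel \<partial>lborel)"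
      by (rule lborel_pair.Fubini') measurable
    also have "\<dots> = (\<integral>\<^sup>+x. (\<integral>\<^sup>+y. indicator A (U x - y) \<partial>lborel) * indicator B (U x) \<partial>lborel)"
      by (simp add: nn_integral_multc)
    also have "\<dots> = (\<integral>\<^sup>+x. emeasure lborel A * indicator B (U x) \<partial>lborel)"
      by (simp add: reflect)
    also have "\<dots> = emeasure lborel A * emeasure lborel (U -` B)"
      by (simp add: nn_integral_cmult ind)
    finally show ?thesis .
  qed
  have ball: "U -` ball 0 1 = ball 0 1" by (auto simp: norm)
  have vol: "emeasure lborel (ball (0::'a) 1) \<noteq> 0" "emeasure lborel (ball (0::'a) 1) \<noteq> \<top>"
    by (simp_all add: emeasure_ball order_less_imp_not_eq2)
  show ?thesis
  proof (rule measure_eqI)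
    fix A :: "'a set" assume "A \<in> sets (distr lborel borel U)"
    then have A: "A \<in> sets borel" by simp
    from swap[OF A, of "ball 0 1"] vol
    have "emeasure lborel (U -` A) = emeasure lborel A"
      by (simp add: ball mult.commute[of _ "emeasure lborel (ball 0 1)"] ennreal_mult_cancel_left)
    then show "emeasure (distr lborel borel U) A = emeasure lborel A"
      using A by (simp add: emeasure_distr)
  qed simp
qed

lemma std_mvnormal_density_radial:
  "(\<Prod>i\<in>UNIV. std_normal_density ((x::real^'n) $ i)) = (1 / sqrt (2 * pi)) ^ CARD('n) * exp (- (norm x)\<^sup>2 / 2)"
proof -
  have "(\<Prod>i\<in>UNIV. std_normal_density (x $ i)) = (\<Prod>i\<in>(UNIV::'n set). 1 / sqrt (2 * pi)) * (\<Prod>i\<in>UNIV. exp (- (x $ i)\<^sup>2 / 2))"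
    unfolding std_normal_density_def by (rule prod.distrib)
  also have "(\<Prod>i\<in>UNIV. exp (- (x $ i)\<^sup>2 / 2)) = exp (- (norm x)\<^sup>2 / 2)"
    unfolding power2_norm_eq_inner inner_vec_def
    by (simp add: exp_sum[symmetric] sum_negf sum_divide_distrib power2_eq_square)
  finally show ?thesis by (simp add: power_one_over)
qed

lemma sets_std_mvnormal [measurable_cong, simp]: "sets (std_mvnormal :: (real^'n) measure) = sets borel"
  by (simp add: std_mvnormal_def)

lemma space_std_mvnormal [simp]: "space std_mvnormal = UNIV"
  by (simp add: std_mvnormal_def)

lemma std_mvnormal_orthogonal:
  fixes U :: "real^'n \<Rightarrow> real^'n"
  assumes "orthogonal_transformation U"
  shows "distr std_mvnormal borel U = std_mvnormal"
proof -
  have norm: "\<And>x. norm (U x) = norm x" and "linear U"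
    using assms by (auto simp: orthogonal_transformation)
  then have [measurable]: "U \<in> borel_measurable borel"
    by (intro borel_measurable_continuous_onI linear_continuous_on) (simp add: linear_conv_bounded_linear)
  let ?g = "\<lambda>x::real^'n. ennreal ((1 / sqrt (2 * pi)) ^ CARD('n) * exp (- (norm x)\<^sup>2 / 2))"
  have "density (distr lborel borel U) ?g = distr (density lborel (\<lambda>x. ?g (U x))) borel U"
    by (rule density_distr) measurable
  then show ?thesis
    by (simp add: std_mvnormal_def std_mvnormal_density_radial norm lborel_orthogonal_invariant[OF assms])
qed

section \<open>Second moments of the standard normal law\<close>

lemma prod_Basis_cart: "(\<Prod>b\<in>(Basis::(real^'n) set). f b) = (\<Prod>i\<in>UNIV. f (axis i 1))"
proof -
  have B: "(Basis::(real^'n) set) = range (\<lambda>i. axis i 1)" by (auto simp: Basis_vec_def)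
  have "inj (\<lambda>i::'n. axis i (1::real))" by (auto simp: inj_def axis_eq_axis)
  then show ?thesis unfolding B by (simp add: prod.reindex)
qed

lemma nn_integral_prod_cart:
  fixes f :: "'n::finite \<Rightarrow> real \<Rightarrow> ennreal"
  assumes [measurable]: "\<And>i. f i \<in> borel_measurable borel"
  shows "(\<integral>\<^sup>+x. (\<Prod>i\<in>UNIV. f i (x $ i)) \<partial>lborel) = (\<Prod>i\<in>UNIV. \<integral>\<^sup>+x. f i x \<partial>lborel)"
proof -
  have "inj (\<lambda>i::'n. axis i (1::real))" by (auto simp: inj_def axis_eq_axis)
  then have inv: "inv (\<lambda>i::'n. axis i (1::real)) (axis i 1) = i" for i by (rule inv_f_f)
  have "(\<integral>\<^sup>+x. (\<Prod>b\<in>Basis. f (inv (\<lambda>i. axis i 1) b) (x \<bullet> b)) \<partial>(lborel :: (real^'n) measure))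
    = (\<Prod>b\<in>(Basis::(real^'n) set). \<integral>\<^sup>+x. f (inv (\<lambda>i. axis i 1) b) x \<partial>lborel)"
    by (rule nn_integral_lborel_prod) auto
  then show ?thesis by (simp add: prod_Basis_cart inv inner_axis)
qed

text \<open>The density is a product, so by Tonelli every other coordinate integrates to \<open>1\<close>.\<close>

lemma nn_integral_std_mvnormal_coord:
  fixes h :: "real \<Rightarrow> real"
  assumes [measurable]: "h \<in> borel_measurable borel" and h: "\<And>x. 0 \<le> h x"
  shows "(\<integral>\<^sup>+z. ennreal (h (z $ k)) \<partial>(std_mvnormal :: (real^'n) measure))
    = (\<integral>\<^sup>+x. ennreal (std_normal_density x * h x) \<partial>lborel)"
proof -
  let ?f = "\<lambda>i x. ennreal (std_normal_density x) * (if i = k then ennreal (h x) else 1)"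
  have one: "(\<integral>\<^sup>+x. ennreal (std_normal_density x) \<partial>lborel) = 1"
    using prob_space.emeasure_space_1[OF prob_space_normal_density[of 1 0]]
    by (simp add: emeasure_density)
  have "(\<integral>\<^sup>+z. ennreal (h (z $ k)) \<partial>(std_mvnormal :: (real^'n) measure))
    = (\<integral>\<^sup>+z. (\<Prod>i\<in>UNIV. ?f i (z $ i)) \<partial>lborel)"
    unfolding std_mvnormal_def
    by (subst nn_integral_density) (simp_all add: prod.distrib prod_ennreal prod_nonneg flip: prod_ennreal)
  also have "\<dots> = (\<Prod>i\<in>UNIV. \<integral>\<^sup>+x. ?f i x \<partial>lborel)"
    by (rule nn_integral_prod_cart) measurable
  also have "\<dots> = (\<Prod>i\<in>UNIV. if i = k then \<integral>\<^sup>+x. ennreal (std_normal_density x * h x) \<partial>lborel else 1)"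
    by (intro prod.cong refl) (auto simp: one ennreal_mult h)
  finally show ?thesis by simp
qed

lemma prob_space_std_mvnormal: "prob_space (std_mvnormal :: (real^'n) measure)"
proof
  have "(\<integral>\<^sup>+z. ennreal 1 \<partial>(std_mvnormal :: (real^'n) measure)) = (\<integral>\<^sup>+x. ennreal (std_normal_density x) \<partial>lborel)"
    using nn_integral_std_mvnormal_coord[of "\<lambda>_. 1"] by simp
  also have "\<dots> = 1"
    using prob_space.emeasure_space_1[OF prob_space_normal_density[of 1 0]]
    by (simp add: emeasure_density)
  finally show "emeasure std_mvnormal (space (std_mvnormal :: (real^'n) measure)) = 1" by simp
qed

lemma std_mvnormal_second_moment:
  "has_bochner_integral (std_mvnormal :: (real^'n) measure) (\<lambda>z. (z $ k)\<^sup>2) 1"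
proof (rule has_bochner_integral_nn_integral)
  have "has_bochner_integral lborel (\<lambda>x. std_normal_density x * x\<^sup>2) 1"
    using std_normal_moment_even[of 1] by simp
  then have "(\<integral>\<^sup>+x. ennreal (std_normal_density x * x\<^sup>2) \<partial>lborel) = 1"
    by (simp add: has_bochner_integral_iff nn_integral_eq_integral)
  then show "(\<integral>\<^sup>+z. ennreal ((z $ k)\<^sup>2) \<partial>(std_mvnormal :: (real^'n) measure)) = ennreal 1"
    by (simp add: nn_integral_std_mvnormal_coord[of "\<lambda>x. x\<^sup>2"])
qed auto

text \<open>Off the diagonal, the law is invariant under a change of sign of the \<open>i\<close>-th coordinate,
  which negates the integrand.\<close>

lemma std_mvnormal_covariance:
  "has_bochner_integral (std_mvnormal :: (real^'n) measure) (\<lambda>z. z $ i * z $ j) (if i = j then 1 else 0)"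
proof (cases "i = j")
  case True
  then show ?thesis using std_mvnormal_second_moment[of i] by (simp add: power2_eq_square)
next
  case False
  have int: "integrable (std_mvnormal :: (real^'n) measure) (\<lambda>z. z $ i * z $ j)"
  proof (rule Bochner_Integration.integrable_bound)
    show "integrable (std_mvnormal :: (real^'n) measure) (\<lambda>z. (z $ i)\<^sup>2 + (z $ j)\<^sup>2)"
      by (intro Bochner_Integration.integrable_add integrable.intros[OF std_mvnormal_second_moment])
    show "AE z in (std_mvnormal :: (real^'n) measure). norm (z $ i * z $ j) \<le> norm ((z $ i)\<^sup>2 + (z $ j)\<^sup>2)"
    proof (rule AE_I2)
      fix z :: "real^'n"
      have "2 * (\<bar>z $ i\<bar> * \<bar>z $ j\<bar>) \<le> (z $ i)\<^sup>2 + (z $ j)\<^sup>2"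
        using sum_squares_bound[of "\<bar>z $ i\<bar>" "\<bar>z $ j\<bar>"] by (simp add: mult_ac)
      moreover have "0 \<le> \<bar>z $ i\<bar> * \<bar>z $ j\<bar>" by simp
      ultimately have "\<bar>z $ i\<bar> * \<bar>z $ j\<bar> \<le> (z $ i)\<^sup>2 + (z $ j)\<^sup>2" by linarith
      then show "norm (z $ i * z $ j) \<le> norm ((z $ i)\<^sup>2 + (z $ j)\<^sup>2)"
        by (simp add: abs_mult)
    qed
  qed measurable
  define R :: "real^'n \<Rightarrow> real^'n" where "R z = (\<chi> k. if k = i then - z $ k else z $ k)" for z
  have R: "orthogonal_transformation R"
    unfolding orthogonal_transformation_def
    by (auto simp: R_def inner_vec_def intro!: linearI sum.cong) (simp_all add: vec_eq_iff)
  then have "linear R" by (rule orthogonal_transformation_linear)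
  then have [measurable]: "R \<in> borel_measurable borel"
    by (intro borel_measurable_continuous_onI linear_continuous_on) (simp add: linear_conv_bounded_linear)
  have "(\<integral>z. z $ i * z $ j \<partial>std_mvnormal) = (\<integral>z. z $ i * z $ j \<partial>distr std_mvnormal borel R)"
    by (simp add: std_mvnormal_orthogonal[OF R])
  also have "\<dots> = (\<integral>z. - (z $ i * z $ j) \<partial>std_mvnormal)"
    using False by (subst integral_distr) (auto simp: R_def)
  finally have "(\<integral>z. z $ i * z $ j \<partial>(std_mvnormal :: (real^'n) measure)) = 0" by simp
  with int False show ?thesis by (simp add: has_bochner_integral_iff)
qed

lemma std_mvnormal_quadratic_form:
  fixes A :: "real^'n^'n"
  shows "has_bochner_integral std_mvnormal (\<lambda>z. z \<bullet> (A *v z)) (trace A)"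
proof -
  have "has_bochner_integral std_mvnormal (\<lambda>z. \<Sum>i\<in>UNIV. \<Sum>j\<in>UNIV. A $ i $ j * (z $ i * z $ j))
    (\<Sum>i\<in>UNIV. \<Sum>j\<in>UNIV. A $ i $ j * (if i = j then 1 else 0))"
    by (intro has_bochner_integral_sum has_bochner_integral_mult_right std_mvnormal_covariance)
  then show ?thesis
    by (simp add: inner_vec_def matrix_vector_mult_def trace_def sum_distrib_left mult_ac if_distrib cong: if_cong)
qed

section \<open>Linear images of the standard normal law\<close>

text \<open>The normal law with covariance \<open>B B\<^sup>T\<close>, presented through the factor \<open>B\<close>: the distance
  between factors then bounds the distance between laws.\<close>

definition gaussian_image :: "real^'n^'n \<Rightarrow> (real^'n) measure" where
  "gaussian_image B = distr std_mvnormal borel ((*v) B)"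

lemma measurable_matrix_vector_mult [measurable]:
  "(*v) (B :: real^'n^'m) \<in> borel_measurable borel"
  by (intro borel_measurable_continuous_onI matrix_vector_mult_linear_continuous_on)

lemma gaussian_image_quadratic_form:
  fixes A B :: "real^'n^'n"
  shows "has_bochner_integral (gaussian_image B) (\<lambda>x::real^'n. x \<bullet> (A *v x)) (B \<bullet> (A ** B))"
proof -
  have "z \<bullet> ((transpose B ** A ** B) *v z) = (B *v z) \<bullet> (A *v (B *v z))" for z
    by (metis dot_lmul_matrix inner_commute matrix_vector_mul_assoc transpose_matrix_vector)
  moreover have "trace (transpose B ** A ** B) = B \<bullet> (A ** B)"
    by (metis mat_inner_def mat_inner_eq_inner matrix_mul_assoc)
  ultimately have "has_bochner_integral std_mvnormal (\<lambda>z. (B *v z) \<bullet> (A *v (B *v z))) (B \<bullet> (A ** B))"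
    using std_mvnormal_quadratic_form[of "transpose B ** A ** B"] by simp
  then show ?thesis
    unfolding gaussian_image_def has_bochner_integral_iff
    by (simp add: integrable_distr_eq integral_distr)
qed

lemma mvnormal_gaussian_image:
  fixes S :: "real^'n^'n"
  assumes "psd S"
  obtains B :: "real^'n^'n" where "B ** transpose B = S" "mvnormal S = gaussian_image B"
proof -
  have "\<exists>B::real^'n^'n. B ** transpose B = S" using psd_factor[OF assms] by metis
  from someI_ex[OF this] show ?thesis
    by (rule that) (simp add: mvnormal_def gaussian_image_def)
qed

text \<open>Any other factor of \<open>C C\<^sup>T\<close> is \<open>C U\<close> with \<open>U\<close> orthogonal, and the standard normal law is
  rotation invariant. Invertibility of \<open>C\<close> provides \<open>U\<close> directly as \<open>C\<^sup>-\<^sup>1\<close> times the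
  other factor.\<close>

lemma mvnormal_gram_invertible:
  fixes C :: "real^'n^'n"
  assumes "invertible C"
  shows "mvnormal (C ** transpose C) = gaussian_image C"
proof -
  obtain B where B: "B ** transpose B = C ** transpose C"
    "mvnormal (C ** transpose C) = gaussian_image B"
    using mvnormal_gaussian_image[OF psd_gram] by blast
  define U where "U = matrix_inv C ** B"
  have inv: "C ** matrix_inv C = mat 1" "matrix_inv C ** C = mat 1"
    using invertible_matrix_inv[OF assms] by auto
  have "U ** transpose U = matrix_inv C ** (B ** transpose B) ** transpose (matrix_inv C)"
    by (simp add: U_def matrix_transpose_mul matrix_mul_assoc)
  also have "\<dots> = (matrix_inv C ** C) ** transpose (matrix_inv C ** C)"
    by (simp add: B matrix_transpose_mul matrix_mul_assoc)
  finally have "U ** transpose U = mat 1" by (simp add: inv)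
  then have "orthogonal_matrix U" by (metis orthogonal_matrix_def matrix_left_right_inverse)
  then have U: "orthogonal_transformation ((*v) U)"
    by (simp add: orthogonal_transformation_matrix matrix_vector_mul_linear)
  have "B = C ** U" by (simp add: U_def matrix_mul_assoc inv)
  then have "(*v) B = (*v) C \<circ> (*v) U" by (auto simp: matrix_vector_mul_assoc)
  then have "gaussian_image B = distr (distr std_mvnormal borel ((*v) U)) borel ((*v) C)"
    unfolding gaussian_image_def by (subst distr_distr) auto
  then show ?thesis
    by (simp add: B std_mvnormal_orthogonal[OF U] gaussian_image_def)
qed

text \<open>Driving both laws by the same standard normal vector transports one to the other at cost
  equal to the squared Frobenius distance of the factors.\<close>

lemma gaussian_image_coupling:
  fixes A B :: "real^'n^'n"
  defines "M \<equiv> distr std_mvnormal (borel \<Otimes>\<^sub>M borel) (\<lambda>z. (A *v z, B *v z))"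
  shows "M \<in> couplings (gaussian_image A) (gaussian_image B)"
    and "(\<integral>z. (norm (fst z - snd z))\<^sup>2 \<partial>M) = (norm (A - B))\<^sup>2"
proof -
  interpret prob_space "std_mvnormal :: (real^'n) measure" by (rule prob_space_std_mvnormal)
  have m [measurable]: "(\<lambda>z. (A *v z, B *v z)) \<in> measurable std_mvnormal (borel \<Otimes>\<^sub>M borel)"
    by measurable
  show "M \<in> couplings (gaussian_image A) (gaussian_image B)"
    unfolding couplings_def M_def gaussian_image_def
    by (auto simp: distr_distr comp_def intro: prob_space_distr)
  have "(\<integral>z. (norm (fst z - snd z))\<^sup>2 \<partial>M) = (\<integral>z. ((A - B) *v z) \<bullet> ((A - B) *v z) \<partial>std_mvnormal)"
    unfolding M_def by (subst integral_distr) (auto simp: power2_norm_eq_inner matrix_vector_mult_diff_rdistrib)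
  also have "\<dots> = (\<integral>x. x \<bullet> (mat 1 *v x) \<partial>gaussian_image (A - B))"
    unfolding gaussian_image_def by (subst integral_distr) auto
  also have "\<dots> = (norm (A - B))\<^sup>2"
    using gaussian_image_quadratic_form[of "A - B" "mat 1"]
    by (simp add: has_bochner_integral_iff power2_norm_eq_inner)
  finally show "(\<integral>z. (norm (fst z - snd z))\<^sup>2 \<partial>M) = (norm (A - B))\<^sup>2" .
qed

lemma wasserstein2_gaussian_image_le:
  "wasserstein2 (gaussian_image A) (gaussian_image B) \<le> norm (A - B)"
proof -
  have "bdd_below ((\<lambda>M. sqrt (\<integral>z. (norm (fst z - snd z))\<^sup>2 \<partial>M)) ` couplings (gaussian_image A) (gaussian_image B))"
    by (intro bdd_belowI2[of _ 0]) simp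
  from cINF_lower[OF this gaussian_image_coupling(1)] show ?thesis
    unfolding wasserstein2_def by (simp add: gaussian_image_coupling(2))
qed

section \<open>A convex quadratic form on a ball\<close>

text \<open>A positive definite quadratic form over a ball has no interior maximum, and at a maximiser
  \<open>c\<close> the gradient \<open>f c\<close> is a nonnegative multiple \<open>g (c - b)\<close> of the outer normal. Comparison of
  \<open>c\<close> with the other points of the sphere shows that \<open>g\<close> dominates the form, which makes
  the Lagrangian with multiplier \<open>g\<close> concave. Being stationary at \<open>c\<close>, it is maximal
  there, so there is no duality gap even though the problem is not a concave one.\<close>

lemma trust_region_multiplier:
  fixes f :: "'a::euclidean_space \<Rightarrow> 'a"
  assumes lin: "linear f" and sym: "\<And>x y. f x \<bullet> y = x \<bullet> f y"
    and pos: "\<And>x. x \<noteq> 0 \<Longrightarrow> 0 < x \<bullet> f x" and r: "0 < r"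
  obtains c g where "c \<in> cball b r" "\<And>y. y \<bullet> f y \<le> g * (y \<bullet> y)"
    "\<And>y. y \<bullet> f y - g * ((norm (y - b))\<^sup>2 - r\<^sup>2) \<le> c \<bullet> f c"
proof -
  have bl: "bounded_linear f" using lin by (simp add: linear_conv_bounded_linear)
  have nonneg: "0 \<le> x \<bullet> f x" for x using pos[of x] by (cases "x = 0") auto
  have expand: "(x + y) \<bullet> f (x + y) = x \<bullet> f x + 2 * (f x \<bullet> y) + y \<bullet> f y" for x y
    using sym[of x y] by (simp add: linear_add[OF lin] inner_add_left inner_add_right inner_commute)
  have scale: "(t *\<^sub>R x) \<bullet> f (t *\<^sub>R x) = t\<^sup>2 * (x \<bullet> f x)" for t x
    by (simp add: linear_cmul[OF lin] power2_eq_square)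
  have "continuous_on (cball b r) (\<lambda>x. x \<bullet> f x)"
    by (intro continuous_intros linear_continuous_on bl)
  moreover have "cball b r \<noteq> {}" using r by simp
  ultimately obtain c where c: "c \<in> cball b r"
    and max: "\<And>y. y \<in> cball b r \<Longrightarrow> y \<bullet> f y \<le> c \<bullet> f c"
    by (metis (lifting) continuous_attains_sup compact_cball)
  define d where "d = c - b"
  have dr: "norm d \<le> r" using c by (simp add: d_def dist_norm norm_minus_commute)
  have maxd: "(c + e) \<bullet> f (c + e) \<le> c \<bullet> f c" if "norm (d + e) \<le> r" for e
    using that by (intro max) (simp add: d_def dist_norm norm_minus_commute algebra_simps)
  have fc0: "f c \<noteq> 0"
  proof -
    obtain y where "y \<in> cball b r" "y \<noteq> 0"
    proof (cases "b = 0")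
      case True
      obtain e :: 'a where "e \<in> Basis" using nonempty_Basis by blast
      then show ?thesis using True r that[of "r *\<^sub>R e"] nonzero_Basis by force
    next
      case False
      with r that[of b] show ?thesis by simp
    qed
    then have "0 < c \<bullet> f c" using max[of y] pos[of y] by simp
    then show ?thesis by auto
  qed
  define g where "g = norm (f c) / r"
  have gr: "g * r = norm (f c)" using r by (simp add: g_def)
  have gpos: "g > 0" using fc0 r by (simp add: g_def)
  \<comment> \<open>A maximiser of a convex function also maximises its linearisation there, so \<open>c\<close> is
    the point of the ball furthest in the direction of the gradient \<open>f c\<close>.\<close>
  have fc: "f c = g *\<^sub>R d"
  proof -
    define e where "e = (1 / g) *\<^sub>R f c - d"
    have "norm (d + e) = r" using gpos gr by (simp add: e_def field_simps)
    then have "2 * (f c \<bullet> e) \<le> 0"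
      using maxd[of e] nonneg[of e] expand[of c e] by linarith
    moreover have "f c = g *\<^sub>R (d + e)" using gpos by (simp add: e_def)
    ultimately have "g * ((d + e) \<bullet> e) \<le> 0" by simp
    then have de: "(d + e) \<bullet> e \<le> 0" using gpos by (simp add: mult_le_0_iff)
    have "(norm d)\<^sup>2 = (norm (d + e))\<^sup>2 - 2 * ((d + e) \<bullet> e) + e \<bullet> e"
      by (simp add: power2_norm_eq_inner inner_add_left inner_add_right inner_commute)
    moreover have "(norm d)\<^sup>2 \<le> r\<^sup>2" using dr r by (intro power_mono) auto
    ultimately have "e \<bullet> e \<le> 0" using de \<open>norm (d + e) = r\<close> by simp
    then have "e = 0" using inner_gt_zero_iff[of e] by (meson not_less)
    then show ?thesis using \<open>f c = g *\<^sub>R (d + e)\<close> by simp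
  qed
  have nd: "norm d = r" using fc gpos gr by (metis abs_of_pos mult_cancel_left norm_scaleR less_irrefl)
  have dd: "d \<bullet> d = r\<^sup>2" using nd by (metis dot_square_norm)
  \<comment> \<open>Reflecting \<open>d\<close> in the hyperplane orthogonal to \<open>e\<close> gives a second point of the
    sphere, and comparing it with the maximiser bounds the form in direction \<open>e\<close>.\<close>
  have transversal: "e \<bullet> f e \<le> g * (e \<bullet> e)" if "d \<bullet> e \<noteq> 0" for e
  proof -
    have ee: "e \<bullet> e > 0" using that by auto
    define t where "t = - 2 * (d \<bullet> e) / (e \<bullet> e)"
    have t0: "t \<noteq> 0" using that ee by (simp add: t_def)
    have te: "t * (e \<bullet> e) = - 2 * (d \<bullet> e)" using ee by (simp add: t_def)
    have "(norm (d + t *\<^sub>R e))\<^sup>2 = d \<bullet> d + 2 * t * (d \<bullet> e) + t * (t * (e \<bullet> e))"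
      by (simp add: power2_norm_eq_inner inner_add_left inner_add_right inner_commute)
    also have "\<dots> = r\<^sup>2" by (simp add: te dd)
    finally have "norm (d + t *\<^sub>R e) = r" using r by (simp add: power2_eq_iff_nonneg)
    from maxd[OF this[THEN eq_refl]] have "2 * (g * (t * (d \<bullet> e))) + t\<^sup>2 * (e \<bullet> f e) \<le> 0"
      using expand[of c "t *\<^sub>R e"] scale[of t e] by (simp add: fc mult.left_commute)
    moreover have "2 * (g * (t * (d \<bullet> e))) = - (t\<^sup>2 * (g * (e \<bullet> e)))"
      using arg_cong[OF te, of "\<lambda>x. g * t * x"] by (simp add: power2_eq_square algebra_simps)
    ultimately have "t\<^sup>2 * (e \<bullet> f e) \<le> t\<^sup>2 * (g * (e \<bullet> e))" by linarith
    then show ?thesis using t0 by simp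
  qed
  have bound: "e \<bullet> f e \<le> g * (e \<bullet> e)" for e
  proof (cases "d \<bullet> e = 0")
    case True
    have d0: "d \<bullet> d > 0" using dd r by simp
    have *: "e \<bullet> f e + 2 * s * (f e \<bullet> d) + s\<^sup>2 * (d \<bullet> f d) \<le> g * (e \<bullet> e + s\<^sup>2 * (d \<bullet> d))" if "s \<noteq> 0" for s
    proof -
      have "d \<bullet> (e + s *\<^sub>R d) \<noteq> 0" using True d0 that by (simp add: inner_add_right)
      from transversal[OF this, unfolded expand scale] show ?thesis
        using True by (simp add: inner_add_left inner_add_right inner_commute power2_eq_square mult.assoc)
    qed
    show ?thesis
    proof (rule field_le_epsilon)
      fix x :: real assume x: "x > 0"
      \<comment> \<open>Adding the estimates for \<open>s\<close> and \<open>- s\<close> cancels the linear term.\<close>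
      define s where "s = sqrt (x / (g * (d \<bullet> d)))"
      have s: "s \<noteq> 0" "g * (s\<^sup>2 * (d \<bullet> d)) = x" using x gpos d0 by (simp_all add: s_def)
      have "0 \<le> s\<^sup>2 * (d \<bullet> f d)" using nonneg by simp
      then show "e \<bullet> f e \<le> g * (e \<bullet> e) + x"
        using *[of s] *[of "- s"] s by (simp add: distrib_left)
    qed
  qed (rule transversal)
  show ?thesis
  proof (rule that[OF c bound])
    fix y
    define e where "e = y - c"
    have y: "y = c + e" "y - b = d + e" by (simp_all add: e_def d_def)
    have "(norm (y - b))\<^sup>2 = r\<^sup>2 + 2 * (d \<bullet> e) + e \<bullet> e"
      unfolding y(2) using dd by (simp add: power2_norm_eq_inner inner_add_left inner_add_right inner_commute)
    then show "y \<bullet> f y - g * ((norm (y - b))\<^sup>2 - r\<^sup>2) \<le> c \<bullet> f c"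
      unfolding y(1) expand using bound[of e] by (simp add: fc algebra_simps)
  qed
qed

section \<open>Duality for the worst-case factor\<close>

text \<open>The inner supremum after every normal law has been replaced by a factor of its covariance
  and the Wasserstein ball by a Frobenius ball around a factor \<open>B\<close> of the nominal
  covariance.\<close>

definition worst_case :: "real \<Rightarrow> real^'n^'n \<Rightarrow> real^'n^'n \<Rightarrow> real" where
  "worst_case r X B = (SUP C\<in>cball B r. C \<bullet> (X ** C))"

text \<open>The Lagrangian dual objective in the multiplier \<open>\<gamma>\<close> of the Wasserstein constraint.\<close>

definition dual_bound :: "real \<Rightarrow> real^'n^'n \<Rightarrow> real^'n^'n \<Rightarrow> real \<Rightarrow> real" where
  "dual_bound r X S \<gamma> = \<gamma> * (r\<^sup>2 - trace S) + \<gamma>\<^sup>2 * mat_inner (matrix_inv (mat \<gamma> - X)) S"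

lemma linear_matrix_mult: "linear (\<lambda>C. X ** (C :: real^'n^'n))"
  by (rule linearI) (simp_all add: vec_eq_iff matrix_matrix_mult_def sum_distrib_left sum.distrib distrib_left mult.left_commute)

lemma matrix_mult_self_adjoint:
  fixes X :: "real^'n^'n"
  assumes "transpose X = X"
  shows "(X ** A) \<bullet> (B :: real^'n^'n) = A \<bullet> (X ** B)"
  by (simp add: inner_matrix_columns column_matrix_mult inner_symmetric_matrix[OF assms])

lemma matrix_form_nonneg:
  fixes X C :: "real^'n^'n"
  assumes "psd X"
  shows "0 \<le> C \<bullet> (X ** C)"
  using assms by (simp add: matrix_form_columns psd_def sum_nonneg)

lemma matrix_form_pos:
  fixes X C :: "real^'n^'n"
  assumes "posdef X" "C \<noteq> 0"
  shows "0 < C \<bullet> (X ** C)"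
proof -
  obtain j where "column j C \<noteq> 0"
    using assms(2) by (auto simp: vec_eq_iff column_def)
  then show ?thesis
    using assms(1) posdef_imp_psd[OF assms(1)]
    unfolding matrix_form_columns posdef_def psd_def by (intro sum_pos2[of _ j]) auto
qed

lemma continuous_on_matrix_form: "continuous_on A (\<lambda>C. C \<bullet> (X ** (C :: real^'n^'n)))"
  by (intro continuous_intros linear_continuous_on linear_matrix_mult[unfolded linear_conv_bounded_linear])

lemma bdd_above_matrix_form: "bdd_above ((\<lambda>C. C \<bullet> (X ** (C :: real^'n^'n))) ` cball B r)"
  by (intro bounded_imp_bdd_above compact_imp_bounded compact_continuous_image continuous_on_matrix_form compact_cball)

text \<open>Test the hypothesis on the matrix all of whose columns equal \<open>x\<close>.\<close>

lemma vector_form_le: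
  fixes X :: "real^'n^'n"
  assumes "\<And>E :: real^'n^'n. E \<bullet> (X ** E) \<le> g * (E \<bullet> E)"
  shows "x \<bullet> (X *v x) \<le> g * (x \<bullet> x)"
proof -
  define E :: "real^'n^'n" where "E = (\<chi> i j. x $ i)"
  have "column j E = x" for j by (simp add: E_def column_def vec_eq_iff)
  then show ?thesis
    using assms[of E] by (simp add: matrix_form_columns inner_matrix_columns[of E E])
qed

lemma worst_case_upper: "norm (C - B) \<le> r \<Longrightarrow> C \<bullet> (X ** C) \<le> worst_case r X B"
  unfolding worst_case_def
  by (intro cSUP_upper bdd_above_matrix_form) (simp add: dist_norm norm_minus_commute)

lemma worst_case_least:
  assumes "0 \<le> r" "\<And>C. norm (C - B) \<le> r \<Longrightarrow> C \<bullet> (X ** C) \<le> u"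
  shows "worst_case r X B \<le> u"
  unfolding worst_case_def using assms
  by (intro cSUP_least) (auto simp: dist_norm norm_minus_commute)

text \<open>Completing the square in \<open>\<xi>\<close>: the reward minus the transport cost from \<open>\<zeta>\<close> is greatest at
  \<open>\<xi> = \<gamma> (\<gamma> I - X)\<^sup>-\<^sup>1 \<zeta>\<close>.\<close>

lemma transport_completion:
  fixes X :: "real^'n^'n"
  assumes "posdef (mat \<gamma> - X)"
  defines "M \<equiv> matrix_inv (mat \<gamma> - X)"
  shows "\<xi> \<bullet> (X *v \<xi>) - \<gamma> * (norm (\<xi> - \<zeta>))\<^sup>2
    = \<gamma>\<^sup>2 * (\<zeta> \<bullet> (M *v \<zeta>)) - \<gamma> * (\<zeta> \<bullet> \<zeta>)
      - (\<xi> - \<gamma> *\<^sub>R (M *v \<zeta>)) \<bullet> ((mat \<gamma> - X) *v (\<xi> - \<gamma> *\<^sub>R (M *v \<zeta>)))"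
proof -
  define P where "P = mat \<gamma> - X"
  define u where "u = M *v \<zeta>"
  have sym: "transpose P = P" using assms(1) by (simp add: P_def posdef_def)
  have Pu: "P *v u = \<zeta>"
    using invertible_matrix_inv(1)[OF posdef_invertible[OF assms(1)]]
    by (simp add: u_def M_def P_def matrix_vector_mul_assoc)
  have X: "X *v \<xi> = \<gamma> *\<^sub>R \<xi> - P *v \<xi>"
    by (simp add: P_def matrix_vector_mult_diff_rdistrib mat_mult_vec)
  have uP: "u \<bullet> (P *v \<xi>) = \<zeta> \<bullet> \<xi>" using inner_symmetric_matrix[OF sym, of u \<xi>] Pu by simp
  show ?thesis
    unfolding P_def[symmetric] u_def[symmetric] X power2_norm_eq_inner
    by (simp add: matrix_vector_mult_diff_distrib matrix_vector_mult_scaleR Pu uP inner_diff_left inner_diff_right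
        power2_eq_square inner_commute algebra_simps)
qed

lemma transport_upper_bound:
  fixes X :: "real^'n^'n"
  assumes "posdef (mat \<gamma> - X)"
  shows "\<xi> \<bullet> (X *v \<xi>) - \<gamma> * (norm (\<xi> - \<zeta>))\<^sup>2
    \<le> \<gamma>\<^sup>2 * (\<zeta> \<bullet> (matrix_inv (mat \<gamma> - X) *v \<zeta>)) - \<gamma> * (\<zeta> \<bullet> \<zeta>)"
proof -
  let ?x = "\<xi> - \<gamma> *\<^sub>R (matrix_inv (mat \<gamma> - X) *v \<zeta>)"
  have "0 \<le> ?x \<bullet> ((mat \<gamma> - X) *v ?x)"
    using posdef_imp_psd[OF assms] unfolding psd_def by blast
  then show ?thesis unfolding transport_completion[OF assms] by linarith
qed

lemma norm_matrix_diff_columns: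
  "(norm (C - B))\<^sup>2 = (\<Sum>j\<in>UNIV. (norm (column j C - column j (B :: real^'n^'n)))\<^sup>2)"
proof -
  have "column j (C - B) = column j C - column j B" for j by (simp add: column_def vec_eq_iff)
  then show ?thesis by (simp add: power2_norm_eq_inner inner_matrix_columns)
qed

text \<open>Writes the dual objective through the optimal values of the transport problems started at
  the columns of \<open>B\<close>.\<close>

lemma dual_bound_columns:
  fixes B :: "real^'n^'n"
  shows "dual_bound r X (B ** transpose B) \<gamma> = \<gamma> * r\<^sup>2 + (\<Sum>j\<in>UNIV.
    \<gamma>\<^sup>2 * (column j B \<bullet> (matrix_inv (mat \<gamma> - X) *v column j B)) - \<gamma> * (column j B \<bullet> column j B))"
  unfolding dual_bound_def mat_inner_eq_inner inner_gram trace_gram matrix_form_columns inner_matrix_columns[of B B]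
  by (simp add: sum_subtractf sum_distrib_left algebra_simps)

lemma posdef_multiplier_pos:
  assumes "posdef X" "posdef (mat \<gamma> - X)"
  shows "0 < \<gamma>"
proof -
  let ?x = "axis undefined 1 :: real^'n"
  have "0 < ?x \<bullet> (X *v ?x)" "0 < ?x \<bullet> ((mat \<gamma> - X) *v ?x)"
    using assms unfolding posdef_def by (metis axis_eq_0_iff zero_neq_one)+
  then have "0 < \<gamma> * (?x \<bullet> ?x)"
    by (simp add: matrix_vector_mult_diff_rdistrib mat_mult_vec inner_diff_right)
  then show ?thesis by (simp add: inner_axis_axis)
qed

text \<open>Weak duality, one column at a time.\<close>

lemma worst_case_le_dual_bound:
  fixes B X :: "real^'n^'n"
  assumes "posdef X" "posdef (mat \<gamma> - X)" "0 \<le> r"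
  shows "worst_case r X B \<le> dual_bound r X (B ** transpose B) \<gamma>"
proof (rule worst_case_least[OF assms(3)])
  fix C assume C: "norm (C - B) \<le> r"
  have "C \<bullet> (X ** C) - \<gamma> * (norm (C - B))\<^sup>2
    = (\<Sum>j\<in>UNIV. column j C \<bullet> (X *v column j C) - \<gamma> * (norm (column j C - column j B))\<^sup>2)"
    by (simp add: matrix_form_columns norm_matrix_diff_columns sum_subtractf sum_distrib_left)
  also have "\<dots> \<le> dual_bound r X (B ** transpose B) \<gamma> - \<gamma> * r\<^sup>2"
    unfolding dual_bound_columns by (simp add: sum_mono transport_upper_bound[OF assms(2)])
  finally have "C \<bullet> (X ** C) \<le> dual_bound r X (B ** transpose B) \<gamma> + \<gamma> * ((norm (C - B))\<^sup>2 - r\<^sup>2)"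
    by (simp add: algebra_simps)
  moreover have "(norm (C - B))\<^sup>2 \<le> r\<^sup>2" using C by (simp add: power_mono)
  then have "\<gamma> * ((norm (C - B))\<^sup>2 - r\<^sup>2) \<le> 0"
    using posdef_multiplier_pos[OF assms(1,2)] by (simp add: mult_le_0_iff)
  ultimately show "C \<bullet> (X ** C) \<le> dual_bound r X (B ** transpose B) \<gamma>" by linarith
qed

text \<open>Strong duality. The multiplier \<open>g\<close> of the trust region problem closes the gap but only
  satisfies \<open>g I \<succeq> X\<close>, where \<open>g I - X\<close> may be singular; a slightly larger multiplier takes
  its place.\<close>

lemma dual_bound_approx:
  fixes B X :: "real^'n^'n"
  assumes X: "posdef X" and r: "0 < r" and e: "0 < e"
  obtains \<gamma> where "posdef (mat \<gamma> - X)" "dual_bound r X (B ** transpose B) \<gamma> \<le> worst_case r X B + e"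
proof -
  have sym: "transpose X = X" using X by (simp add: posdef_def)
  obtain C g where C: "C \<in> cball B r" and g: "\<And>E :: real^'n^'n. E \<bullet> (X ** E) \<le> g * (E \<bullet> E)"
    and opt: "\<And>E. E \<bullet> (X ** E) - g * ((norm (E - B))\<^sup>2 - r\<^sup>2) \<le> C \<bullet> (X ** C)"
    by (rule trust_region_multiplier[OF linear_matrix_mult matrix_mult_self_adjoint[OF sym] matrix_form_pos[OF X] r,
          where b = B]) (assumption, rule that)
  \<comment> \<open>Raising the multiplier by \<open>e / r\<^sup>2\<close> costs at most \<open>e\<close> in the dual objective.\<close>
  define \<gamma> where "\<gamma> = g + e / r\<^sup>2"
  have \<gamma>: "g < \<gamma>" using e r by (simp add: \<gamma>_def)
  have pd: "posdef (mat \<gamma> - X)"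
    unfolding posdef_def
  proof (intro conjI allI impI)
    show "transpose (mat \<gamma> - X) = mat \<gamma> - X" by (simp add: transpose_diff sym)
    fix x :: "real^'n" assume "x \<noteq> 0"
    then have xx: "0 < x \<bullet> x" by simp
    have "x \<bullet> (X *v x) \<le> g * (x \<bullet> x)" by (rule vector_form_le[OF g])
    also have "\<dots> < \<gamma> * (x \<bullet> x)" using \<gamma> xx by simp
    finally show "0 < x \<bullet> ((mat \<gamma> - X) *v x)"
      by (simp add: matrix_vector_mult_diff_rdistrib mat_mult_vec inner_diff_right)
  qed
  define M where "M = matrix_inv (mat \<gamma> - X)"
  \<comment> \<open>The factor at which completing the square is an equality in every column.\<close>
  define E where "E = \<gamma> *\<^sub>R (M ** B)"
  have col: "column j E = \<gamma> *\<^sub>R (M *v column j B)" for j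
    unfolding E_def column_matrix_mult[symmetric] by (simp add: column_def vec_eq_iff)
  have "dual_bound r X (B ** transpose B) \<gamma> = \<gamma> * r\<^sup>2 +
     (\<Sum>j\<in>UNIV. column j E \<bullet> (X *v column j E) - \<gamma> * (norm (column j E - column j B))\<^sup>2)"
    unfolding dual_bound_columns transport_completion[OF pd] by (simp add: col M_def)
  also have "\<dots> = E \<bullet> (X ** E) - \<gamma> * ((norm (E - B))\<^sup>2 - r\<^sup>2)"
    by (simp add: matrix_form_columns norm_matrix_diff_columns sum_subtractf sum_distrib_left algebra_simps)
  also have "\<dots> \<le> C \<bullet> (X ** C) + (\<gamma> - g) * (r\<^sup>2 - (norm (E - B))\<^sup>2)"
    using opt[of E] by (simp add: algebra_simps)
  also have "\<dots> \<le> C \<bullet> (X ** C) + (\<gamma> - g) * r\<^sup>2"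
    using \<gamma> by (intro add_left_mono mult_left_mono) auto
  also have "\<dots> \<le> worst_case r X B + e"
    using C r worst_case_upper[of C B r X] by (simp add: \<gamma>_def dist_norm norm_minus_commute)
  finally show ?thesis using that pd by blast
qed

section \<open>Dependence of the worst case on the nominal covariance\<close>

text \<open>By convexity the average of the form at \<open>B + D\<close> and \<open>B - D\<close> is at least its value at
  \<open>D\<close>, wherever the ball is centred. Hence the worst case controls the size of \<open>X\<close>
  uniformly in \<open>B\<close>.\<close>

lemma form_le_worst_case:
  fixes X B E :: "real^'n^'n"
  assumes X: "psd X" and r: "0 < r"
  shows "E \<bullet> (X ** E) \<le> worst_case r X B / r\<^sup>2 * (E \<bullet> E)"
proof (cases "E = 0")
  case False
  define t where "t = r / norm E"
  have t: "t > 0" using r False by (simp add: t_def)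
  define D where "D = t *\<^sub>R E"
  have D: "norm D = r" using r False by (simp add: D_def t_def)
  have scale: "X ** (c *\<^sub>R A) = c *\<^sub>R (X ** A)" for c and A :: "real^'n^'n"
    by (rule linear_cmul[OF linear_matrix_mult])
  have "2 * (D \<bullet> (X ** D)) \<le> (B + D) \<bullet> (X ** (B + D)) + (B - D) \<bullet> (X ** (B - D))"
    using matrix_form_nonneg[OF X, of B]
    by (simp add: linear_add[OF linear_matrix_mult] linear_diff[OF linear_matrix_mult]
        inner_add_left inner_add_right inner_diff_left inner_diff_right)
  also have "\<dots> \<le> 2 * worst_case r X B"
    using worst_case_upper[of "B + D" B r X] worst_case_upper[of "B - D" B r X] D by simp
  finally have "t\<^sup>2 * (E \<bullet> (X ** E)) \<le> worst_case r X B"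
    by (simp add: D_def scale power2_eq_square)
  then have "E \<bullet> (X ** E) \<le> worst_case r X B / t\<^sup>2" using t by (simp add: field_simps)
  also have "\<dots> = worst_case r X B / r\<^sup>2 * (E \<bullet> E)"
    by (simp add: t_def power_divide power2_norm_eq_inner)
  finally show ?thesis .
qed simp

lemma worst_case_pos:
  fixes X :: "real^'n^'n"
  assumes "posdef X" "0 < r"
  shows "0 < worst_case r X B"
proof -
  have "mat 1 \<noteq> (0 :: real^'n^'n)" by (simp add: mat_def vec_eq_iff)
  then have "0 < (mat 1 :: real^'n^'n) \<bullet> (X ** mat 1)" "0 < (mat 1 :: real^'n^'n) \<bullet> mat 1"
    by (auto intro: matrix_form_pos[OF assms(1)] simp del: matrix_mul_rid)
  with form_le_worst_case[OF posdef_imp_psd[OF assms(1)] assms(2), of "mat 1" B]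
  have "0 < worst_case r X B / r\<^sup>2 * ((mat 1 :: real^'n^'n) \<bullet> mat 1)" by linarith
  then show ?thesis
    using \<open>0 < (mat 1 :: real^'n^'n) \<bullet> mat 1\<close> assms(2) by (simp add: zero_less_mult_iff zero_less_divide_iff)
qed

text \<open>Moving the centre by \<open>E\<close> costs at most the form at \<open>E\<close> and a cross term; both are
  fractions of the worst case itself by the bound \<open>form_le_worst_case\<close>. The relative error is therefore
  uniform over all \<open>X\<close>, which is what makes the infimum over an arbitrary set of \<open>X\<close>
  continuous.\<close>

lemma worst_case_perturb:
  fixes X B B' :: "real^'n^'n"
  assumes X: "psd X" and r: "0 < r"
  shows "worst_case r X B' \<le> (1 + norm (B' - B) / r)\<^sup>2 * worst_case r X B"
proof (rule worst_case_least)
  fix C assume C: "norm (C - B') \<le> r"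
  define E where "E = B' - B"
  define t where "t = norm E / r"
  define w where "w = worst_case r X B"
  have w: "(C - E) \<bullet> (X ** (C - E)) \<le> w"
    unfolding w_def by (rule worst_case_upper) (use C in \<open>simp add: E_def algebra_simps\<close>)
  have E: "E \<bullet> (X ** E) \<le> t\<^sup>2 * w"
    using form_le_worst_case[OF X r, of E B] by (simp add: t_def w_def power_divide power2_norm_eq_inner mult.commute)
  show "C \<bullet> (X ** C) \<le> (1 + norm (B' - B) / r)\<^sup>2 * worst_case r X B"
    unfolding E_def[symmetric] t_def[symmetric] w_def[symmetric]
  proof (cases "E = 0")
    case True
    then show "C \<bullet> (X ** C) \<le> (1 + t)\<^sup>2 * w" using w by (simp add: t_def)
  next
    case False
    then have t: "t > 0" using r by (simp add: t_def)
    define A where "A = C - E"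
    note simps = linear_add[OF linear_matrix_mult] linear_diff[OF linear_matrix_mult]
      linear_cmul[OF linear_matrix_mult] inner_add_left inner_add_right inner_diff_left inner_diff_right
    \<comment> \<open>This choice of \<open>t\<close> makes the resulting bound a perfect square.\<close>
    have "0 \<le> (t *\<^sub>R A - E) \<bullet> (X ** (t *\<^sub>R A - E))" by (rule matrix_form_nonneg[OF X])
    also have "\<dots> = t\<^sup>2 * (A \<bullet> (X ** A)) - t * (A \<bullet> (X ** E) + E \<bullet> (X ** A)) + E \<bullet> (X ** E)"
      by (simp add: simps power2_eq_square algebra_simps)
    finally have "t * (A \<bullet> (X ** E) + E \<bullet> (X ** A)) \<le> t\<^sup>2 * w + t\<^sup>2 * w"
      using E mult_left_mono[OF w[folded A_def] zero_le_power2[of t]] by linarith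
    then have "t * (A \<bullet> (X ** E) + E \<bullet> (X ** A)) \<le> t * (2 * t * w)"
      by (simp add: power2_eq_square mult_ac)
    then have cross: "A \<bullet> (X ** E) + E \<bullet> (X ** A) \<le> 2 * t * w" using t by simp
    have "C \<bullet> (X ** C) = A \<bullet> (X ** A) + (A \<bullet> (X ** E) + E \<bullet> (X ** A)) + E \<bullet> (X ** E)"
      unfolding A_def by (simp add: simps)
    also have "\<dots> \<le> w + 2 * t * w + t\<^sup>2 * w" using w cross E unfolding A_def by linarith
    also have "\<dots> = (1 + t)\<^sup>2 * w" by (simp add: power2_eq_square algebra_simps)
    finally show "C \<bullet> (X ** C) \<le> (1 + t)\<^sup>2 * w" .
  qed
qed (use r in simp)

text \<open>The coefficient \<open>\<gamma>\<^sup>2 (\<gamma> I - X)\<^sup>-\<^sup>1 - \<gamma> I\<close> of \<open>S\<close> is positive semidefinite: its form at \<open>x\<close> is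
  the optimal transport reward from \<open>x\<close>, and not moving already earns \<open>x \<bullet> X x \<ge> 0\<close>.\<close>

lemma dual_bound_mono:
  fixes X S S' :: "real^'n^'n"
  assumes X: "psd X" and pd: "posdef (mat \<gamma> - X)" and "psd (S' - S)"
  shows "dual_bound r X S \<gamma> \<le> dual_bound r X S' \<gamma>"
proof -
  obtain C :: "real^'n^'n" where C: "C ** transpose C = S' - S" using psd_factor assms(3) by blast
  have S': "S' = S + C ** transpose C" by (simp add: C)
  have "dual_bound r X S' \<gamma> - dual_bound r X S \<gamma> = dual_bound 0 X (C ** transpose C) \<gamma>"
    by (simp add: dual_bound_def S' mat_inner_eq_inner inner_add_right trace_add algebra_simps)
  also have "\<dots> \<ge> 0"
  proof -
    have "0 \<le> \<gamma>\<^sup>2 * (x \<bullet> (matrix_inv (mat \<gamma> - X) *v x)) - \<gamma> * (x \<bullet> x)" for x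
    proof -
      have "0 \<le> x \<bullet> (X *v x)" using X by (simp add: psd_def)
      then show ?thesis using transport_upper_bound[OF pd, of x x] by simp
    qed
    then show ?thesis unfolding dual_bound_columns by (simp add: sum_nonneg)
  qed
  finally show ?thesis by simp
qed

lemma worst_case_mono:
  fixes X B B' :: "real^'n^'n"
  assumes X: "posdef X" and r: "0 < r"
    and psd: "psd (B' ** transpose B' - B ** transpose B)"
  shows "worst_case r X B \<le> worst_case r X B'"
proof (rule field_le_epsilon)
  fix e :: real assume "0 < e"
  then obtain \<gamma> where pd: "posdef (mat \<gamma> - X)"
    and \<gamma>: "dual_bound r X (B' ** transpose B') \<gamma> \<le> worst_case r X B' + e"
    using dual_bound_approx[OF X r] by blast
  have "worst_case r X B \<le> dual_bound r X (B ** transpose B) \<gamma>"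
    using worst_case_le_dual_bound[OF X pd] r by simp
  also have "\<dots> \<le> dual_bound r X (B' ** transpose B') \<gamma>"
    by (rule dual_bound_mono[OF posdef_imp_psd[OF X] pd psd])
  finally show "worst_case r X B \<le> worst_case r X B' + e" using \<gamma> by simp
qed

lemma psd_zero: "psd 0"
  by (simp add: psd_def transpose_def vec_eq_iff)

text \<open>The dual objective depends on \<open>B\<close> only through \<open>B B\<^sup>T\<close>, hence so does the worst case.\<close>

lemma worst_case_cong:
  assumes "posdef X" "0 < r" "B ** transpose B = B' ** transpose B'"
  shows "worst_case r X B = worst_case r X B'"
  using assms by (intro antisym worst_case_mono) (simp_all add: psd_zero)

text \<open>The additive constant left by \<open>ln y \<le> y - 1\<close> at \<open>y = w / (2 p)\<close>, applied to
  \<open>ln (p! (w / r\<^sup>2)\<^sup>p)\<close>, where \<open>w\<close> is the worst case.\<close>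

definition log_det_const :: "nat \<Rightarrow> real \<Rightarrow> real" where
  "log_det_const p r = ln (fact p) + p * ln (2 * p / r\<^sup>2)"

lemma abs_entry_le:
  fixes X :: "real^'n^'n"
  assumes X: "psd X" and bound: "\<And>x. x \<bullet> (X *v x) \<le> m * (x \<bullet> x)"
  shows "\<bar>X $ i $ j\<bar> \<le> m"
proof -
  have ip: "axis a 1 \<bullet> (X *v axis b 1) = X $ a $ b" for a b
    by (simp add: matrix_vector_mult_basis inner_axis' column_def)
  have sym: "X $ j $ i = X $ i $ j" using X unfolding psd_def by (metis transpose_def vec_lambda_beta)
  have diag: "X $ k $ k \<le> m" for k using bound[of "axis k 1"] by (simp add: ip inner_axis_axis)
  have "0 \<le> (axis i 1 + axis j 1) \<bullet> (X *v (axis i 1 + axis j 1))"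
    "0 \<le> (axis i 1 - axis j 1) \<bullet> (X *v (axis i 1 - axis j 1))"
    using X unfolding psd_def by blast+
  then have "\<bar>X $ i $ j\<bar> \<le> (X $ i $ i + X $ j $ j) / 2"
    by (simp add: matrix_vector_right_distrib matrix_vector_mult_diff_distrib inner_add_left inner_add_right
        inner_diff_left inner_diff_right ip sym)
  then show ?thesis using diag[of i] diag[of j] by simp
qed

text \<open>The logarithm of the determinant grows only logarithmically in the entries of \<open>X\<close>, hence
  in the worst case, while the objective contains the worst case linearly. Half of the latter
  therefore absorbs the former, with a constant that depends on neither \<open>X\<close> nor \<open>B\<close>.\<close>

lemma ln_det_le_worst_case:
  fixes X :: "real^'n^'n"
  assumes X: "posdef X" and r: "0 < r"
  shows "ln (det X) \<le> worst_case r X B / 2 + log_det_const CARD('n) r"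
proof -
  let ?p = "CARD('n)"
  define w where "w = worst_case r X B"
  have w: "w > 0" unfolding w_def by (rule worst_case_pos[OF X r])
  have p: "0 < real ?p" by simp
  have "det X \<le> fact ?p * (w / r\<^sup>2) ^ ?p"
  proof (rule det_le_entries)
    fix i j
    have "x \<bullet> (X *v x) \<le> w / r\<^sup>2 * (x \<bullet> x)" for x
      by (rule vector_form_le) (unfold w_def, rule form_le_worst_case[OF posdef_imp_psd[OF X] r])
    then show "\<bar>X $ i $ j\<bar> \<le> w / r\<^sup>2" by (rule abs_entry_le[OF posdef_imp_psd[OF X]])
  qed
  then have "ln (det X) \<le> ln (fact ?p * (w / r\<^sup>2) ^ ?p)"
    using det_posdef_pos[OF X] by simp
  also have "\<dots> = ln (fact ?p) + ?p * ln (w / r\<^sup>2)"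
    using w r by (subst ln_mult_pos) (simp_all add: ln_realpow)
  finally have "ln (det X) \<le> ln (fact ?p) + ?p * ln (w / r\<^sup>2)" .
  moreover have "?p * ln (w / r\<^sup>2) \<le> w / 2 + ?p * ln (2 * ?p / r\<^sup>2)"
  proof -
    \<comment> \<open>The split point \<open>2 p\<close> gives \<open>w\<close> the coefficient \<open>1/2\<close> after multiplication by \<open>p\<close>.\<close>
    have "w / r\<^sup>2 = (w / (2 * ?p)) * (2 * ?p / r\<^sup>2)" using p by simp
    moreover have "ln ((w / (2 * ?p)) * (2 * ?p / r\<^sup>2)) = ln (w / (2 * ?p)) + ln (2 * ?p / r\<^sup>2)"
      by (rule ln_mult_pos) (use w r p in auto)
    ultimately have "ln (w / r\<^sup>2) = ln (w / (2 * ?p)) + ln (2 * ?p / r\<^sup>2)" by simp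
    also have "\<dots> \<le> w / (2 * ?p) + ln (2 * ?p / r\<^sup>2)"
      using w p ln_le_minus_one[of "w / (2 * ?p)"] by simp
    finally have "?p * ln (w / r\<^sup>2) \<le> ?p * (w / (2 * ?p) + ln (2 * ?p / r\<^sup>2))"
      by (rule mult_left_mono) simp
    also have "\<dots> = w / 2 + ?p * ln (2 * ?p / r\<^sup>2)" by (simp add: distrib_left)
    finally show ?thesis .
  qed
  ultimately show ?thesis by (simp add: w_def log_det_const_def)
qed

section \<open>The supremum over the ambiguity set\<close>

text \<open>Integrates the pointwise transport bound against an arbitrary coupling. The radius of the
  dual objective is the cost of that coupling.\<close>

lemma coupling_expectation_le:
  fixes X B C :: "real^'n^'n"
  assumes pd: "posdef (mat \<gamma> - X)" and M: "M \<in> couplings (gaussian_image C) (gaussian_image B)"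
  shows "C \<bullet> (X ** C) \<le> dual_bound (sqrt (\<integral>z. (norm (fst z - snd z))\<^sup>2 \<partial>M)) X (B ** transpose B) \<gamma>"
proof -
  have sets [measurable_cong]: "sets M = sets (borel \<Otimes>\<^sub>M borel)"
    and d1: "distr M borel fst = gaussian_image C" and d2: "distr M borel snd = gaussian_image B"
    using M by (auto simp: couplings_def)
  have [measurable]: "fst \<in> borel_measurable M" "snd \<in> borel_measurable M"
    by (simp_all add: measurable_cong_sets[OF sets refl])
  have fst: "has_bochner_integral M (\<lambda>z. fst z \<bullet> (A *v fst z)) (C \<bullet> (A ** C))" for A
    using gaussian_image_quadratic_form[of C A] unfolding d1[symmetric] has_bochner_integral_iff
    by (simp add: integrable_distr_eq integral_distr)
  have snd: "has_bochner_integral M (\<lambda>z. snd z \<bullet> (A *v snd z)) (B \<bullet> (A ** B))" for A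
    using gaussian_image_quadratic_form[of B A] unfolding d2[symmetric] has_bochner_integral_iff
    by (simp add: integrable_distr_eq integral_distr)
  define R where "R = matrix_inv (mat \<gamma> - X)"
  have cost: "integrable M (\<lambda>z. (norm (fst z - snd z))\<^sup>2)"
  proof (rule Bochner_Integration.integrable_bound)
    show "integrable M (\<lambda>z. 2 * (fst z \<bullet> (mat 1 *v fst z)) + 2 * (snd z \<bullet> (mat 1 *v snd z)))"
      by (intro Bochner_Integration.integrable_add integrable_mult_right integrable.intros[OF fst] integrable.intros[OF snd])
    show "AE z in M. norm ((norm (fst z - snd z))\<^sup>2)
      \<le> norm (2 * (fst z \<bullet> (mat 1 *v fst z)) + 2 * (snd z \<bullet> (mat 1 *v snd z)))"
    proof (rule AE_I2)
      fix z :: "(real^'n) \<times> (real^'n)"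
      have "0 \<le> (fst z + snd z) \<bullet> (fst z + snd z)" "0 \<le> (fst z - snd z) \<bullet> (fst z - snd z)"
        by (rule inner_ge_zero)+
      then show "norm ((norm (fst z - snd z))\<^sup>2)
        \<le> norm (2 * (fst z \<bullet> (mat 1 *v fst z)) + 2 * (snd z \<bullet> (mat 1 *v snd z)))"
        by (simp add: power2_norm_eq_inner inner_add_left inner_add_right inner_diff_left inner_diff_right inner_commute)
    qed
  qed measurable
  define I where "I = (\<integral>z. (norm (fst z - snd z))\<^sup>2 \<partial>M)"
  have cost': "has_bochner_integral M (\<lambda>z. (norm (fst z - snd z))\<^sup>2) I"
    using cost by (simp add: has_bochner_integral_iff I_def)
  have "C \<bullet> (X ** C) - \<gamma> * I = (\<integral>z. fst z \<bullet> (X *v fst z) - \<gamma> * (norm (fst z - snd z))\<^sup>2 \<partial>M)"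
    by (intro has_bochner_integral_integral_eq[symmetric] has_bochner_integral_diff
        has_bochner_integral_mult_right fst cost')
  also have "\<dots> \<le> (\<integral>z. \<gamma>\<^sup>2 * (snd z \<bullet> (R *v snd z)) - \<gamma> * (snd z \<bullet> (mat 1 *v snd z)) \<partial>M)"
  proof (rule integral_mono)
    show "integrable M (\<lambda>z. fst z \<bullet> (X *v fst z) - \<gamma> * (norm (fst z - snd z))\<^sup>2)"
      by (intro Bochner_Integration.integrable_diff integrable_mult_right cost integrable.intros[OF fst])
    show "integrable M (\<lambda>z. \<gamma>\<^sup>2 * (snd z \<bullet> (R *v snd z)) - \<gamma> * (snd z \<bullet> (mat 1 *v snd z)))"
      by (intro Bochner_Integration.integrable_diff integrable_mult_right integrable.intros[OF snd])
  qed (simp add: R_def transport_upper_bound[OF pd])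
  also have "\<dots> = \<gamma>\<^sup>2 * (B \<bullet> (R ** B)) - \<gamma> * (B \<bullet> (mat 1 ** B))"
    by (intro has_bochner_integral_integral_eq has_bochner_integral_diff has_bochner_integral_mult_right snd)
  finally have "C \<bullet> (X ** C) - \<gamma> * I \<le> \<gamma>\<^sup>2 * (B \<bullet> (R ** B)) - \<gamma> * (B \<bullet> B)" by simp
  moreover have "0 \<le> I" by (simp add: I_def)
  ultimately show ?thesis
    unfolding I_def[symmetric] dual_bound_def mat_inner_eq_inner inner_gram trace_gram R_def[symmetric]
    by (simp add: algebra_simps)
qed

text \<open>A bound \<open>r\<close> on an infimum over couplings yields couplings of every cost above \<open>r\<close>, so
  estimates through couplings reach radius \<open>r\<close> only in the limit.\<close>

lemma dual_bound_radius_limit: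
  assumes "\<And>d. r < d \<Longrightarrow> u \<le> dual_bound d X S \<gamma>"
  shows "u \<le> dual_bound r X S \<gamma>"
proof (rule tendsto_lowerbound)
  show "((\<lambda>d. dual_bound d X S \<gamma>) \<longlongrightarrow> dual_bound r X S \<gamma>) (at_right r)"
    unfolding dual_bound_def by (intro tendsto_intros)
  show "\<forall>\<^sub>F d in at_right r. u \<le> dual_bound d X S \<gamma>"
    using assms by (auto simp: eventually_at_right_less intro: eventually_mono[OF eventually_at_right_less])
qed simp

lemma dual_bound_radius_mono:
  assumes "0 < \<gamma>" "0 \<le> r" "r \<le> d"
  shows "dual_bound r X S \<gamma> \<le> dual_bound d X S \<gamma>"
  using assms power_mono[of r d 2] by (simp add: dual_bound_def)

lemma ambiguous_expectation_le_dual: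
  fixes X B C :: "real^'n^'n"
  assumes X: "posdef X" and pd: "posdef (mat \<gamma> - X)"
    and W: "wasserstein2 (gaussian_image C) (gaussian_image B) \<le> r"
  shows "C \<bullet> (X ** C) \<le> dual_bound r X (B ** transpose B) \<gamma>"
proof (rule dual_bound_radius_limit)
  fix d assume "r < d"
  let ?cost = "\<lambda>M. sqrt (\<integral>z. (norm (fst z - snd z))\<^sup>2 \<partial>M)"
  let ?\<Pi> = "couplings (gaussian_image C) (gaussian_image B)"
  have "(INF M\<in>?\<Pi>. ?cost M) < d" using W \<open>r < d\<close> unfolding wasserstein2_def by linarith
  moreover have "?\<Pi> \<noteq> {}" using gaussian_image_coupling(1) by blast
  moreover have "bdd_below (?cost ` ?\<Pi>)" by (intro bdd_belowI2[of _ 0]) simp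
  ultimately obtain M where M: "M \<in> ?\<Pi>" "?cost M < d" by (auto simp: cINF_less_iff)
  have "C \<bullet> (X ** C) \<le> dual_bound (?cost M) X (B ** transpose B) \<gamma>"
    by (rule coupling_expectation_le[OF pd M(1)])
  also have "\<dots> \<le> dual_bound d X (B ** transpose B) \<gamma>"
    using M(2) by (intro dual_bound_radius_mono posdef_multiplier_pos[OF X pd]) auto
  finally show "C \<bullet> (X ** C) \<le> dual_bound d X (B ** transpose B) \<gamma>" .
qed

text \<open>Invertible factors suffice to approach the worst case, because the points of the open ball
  where the form is nearly maximal form a nonempty open set.\<close>

lemma invertible_near_worst_case:
  fixes X B :: "real^'n^'n"
  assumes r: "0 < r" and e: "0 < e"
  obtains C where "invertible C" "norm (C - B) \<le> r" "worst_case r X B < C \<bullet> (X ** C) + e"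
proof -
  define V where "V = {C :: real^'n^'n. worst_case r X B - e < C \<bullet> (X ** C)}"
  have "open V"
    unfolding V_def by (intro open_Collect_less continuous_intros continuous_on_matrix_form)
  have "cball B r \<noteq> {}" using r by simp
  moreover have "worst_case r X B - e < (SUP C\<in>cball B r. C \<bullet> (X ** C))"
    using e by (simp add: worst_case_def)
  ultimately have "V \<inter> cball B r \<noteq> {}"
    by (auto simp: less_cSUP_iff bdd_above_matrix_form V_def)
  then have "V \<inter> ball B r \<noteq> {}"
    using open_Int_closure_eq_empty[OF \<open>open V\<close>, of "ball B r"] r by simp
  then obtain C0 where "C0 \<in> V \<inter> ball B r" by blast
  moreover have "open (V \<inter> ball B r)" using \<open>open V\<close> by auto
  ultimately obtain C where "C \<in> V \<inter> ball B r" "invertible C" using open_contains_invertible by blast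
  then show ?thesis using that[of C] by (auto simp: V_def dist_norm norm_minus_commute)
qed

lemma gaussian_image_expectation:
  fixes X C :: "real^'n^'n"
  shows "(\<integral>\<xi>. mat_inner (outer \<xi>) X \<partial>gaussian_image C) = C \<bullet> (X ** C)"
  using gaussian_image_quadratic_form[of C X]
  by (simp add: mat_inner_eq_inner inner_outer has_bochner_integral_iff)

text \<open>Laws in the ambiguity set are bounded through weak duality for couplings and the absence of
  a gap. Conversely every invertible factor near a factor of \<open>S\<close> gives a law in the set, by the
  synchronous coupling.\<close>

lemma SUP_ambiguity_set:
  fixes X S B :: "real^'n^'n"
  assumes X: "posdef X" and \<rho>: "0 < \<rho>" and S: "B ** transpose B = S"
  shows "(SUP Q\<in>ambiguity_set \<rho> S. ereal (\<integral>\<xi>. mat_inner (outer \<xi>) X \<partial>Q)) = ereal (worst_case \<rho> X B)"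
    (is "?sup = _")
proof (rule antisym)
  have psdS: "psd S" using S psd_gram by blast
  then obtain B0 where B0: "B0 ** transpose B0 = S" "mvnormal S = gaussian_image B0"
    using mvnormal_gaussian_image by blast
  have wc: "worst_case \<rho> X B = worst_case \<rho> X B0"
    by (rule worst_case_cong[OF X \<rho>]) (simp add: S B0)
  show "?sup \<le> ereal (worst_case \<rho> X B)"
  proof (rule SUP_least)
    fix Q assume "Q \<in> ambiguity_set \<rho> S"
    then obtain \<Sigma> where "psd \<Sigma>" "Q = mvnormal \<Sigma>" and W: "wasserstein2 Q (mvnormal S) \<le> \<rho>"
      by (auto simp: ambiguity_set_def zero_mean_normals_def)
    then obtain C where Q: "Q = gaussian_image C" using mvnormal_gaussian_image by metis
    have "C \<bullet> (X ** C) \<le> worst_case \<rho> X B0"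
    proof (rule field_le_epsilon)
      fix e :: real assume "0 < e"
      then obtain \<gamma> where pd: "posdef (mat \<gamma> - X)"
        and \<gamma>: "dual_bound \<rho> X (B0 ** transpose B0) \<gamma> \<le> worst_case \<rho> X B0 + e"
        using dual_bound_approx[OF X \<rho>] by blast
      have "C \<bullet> (X ** C) \<le> dual_bound \<rho> X (B0 ** transpose B0) \<gamma>"
        using W by (intro ambiguous_expectation_le_dual[OF X pd]) (simp add: Q B0)
      then show "C \<bullet> (X ** C) \<le> worst_case \<rho> X B0 + e" using \<gamma> by simp
    qed
    then show "ereal (\<integral>\<xi>. mat_inner (outer \<xi>) X \<partial>Q) \<le> ereal (worst_case \<rho> X B)"
      by (simp add: Q gaussian_image_expectation wc)
  qed
  show "ereal (worst_case \<rho> X B) \<le> ?sup"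
  proof (rule ereal_le_epsilon2)
    fix e :: real assume "0 < e"
    then obtain C where C: "invertible C" "norm (C - B0) \<le> \<rho>" "worst_case \<rho> X B0 < C \<bullet> (X ** C) + e"
      using invertible_near_worst_case[OF \<rho>] by blast
    have "gaussian_image C \<in> ambiguity_set \<rho> S"
      using wasserstein2_gaussian_image_le[of C B0] C(2) psd_gram[of C] mvnormal_gram_invertible[OF C(1)]
      by (force simp: ambiguity_set_def zero_mean_normals_def B0)
    then have "ereal (C \<bullet> (X ** C)) \<le> ?sup"
      by (intro SUP_upper2[of "gaussian_image C"]) (simp_all add: gaussian_image_expectation)
    then have "ereal (C \<bullet> (X ** C)) + ereal e \<le> ?sup + ereal e" by (rule add_right_mono)
    moreover have "ereal (worst_case \<rho> X B) \<le> ereal (C \<bullet> (X ** C)) + ereal e" using C(3) by (simp add: wc)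
    ultimately show "ereal (worst_case \<rho> X B) \<le> ?sup + ereal e" by (rule order_trans[rotated])
  qed
qed

section \<open>The dual problem\<close>

lemma dro_value_worst_case:
  fixes \<X> :: "(real^'n^'n) set"
  assumes "0 < \<rho>" "\<X> \<subseteq> {X. posdef X}" "B ** transpose B = S"
  shows "dro_value \<rho> \<X> S = (INF X\<in>\<X>. ereal (- ln (det X) + worst_case \<rho> X B))"
  unfolding dro_value_def using assms by (intro INF_cong refl) (auto simp: SUP_ambiguity_set)

lemma dro_value_dual:
  fixes \<X> :: "(real^'n^'n) set"
  assumes \<rho>: "0 < \<rho>" and \<X>: "\<X> \<subseteq> {X. posdef X}" and S: "psd S"
  shows "dro_value \<rho> \<X> S =
    (INF (X, \<gamma>) \<in> {(X, \<gamma>). posdef (mat \<gamma> - X) \<and> posdef X \<and> X \<in> \<X>}.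
       ereal (- ln (det X) + dual_bound \<rho> X S \<gamma>))" (is "_ = Inf (?g ` ?P)")
proof -
  obtain B :: "real^'n^'n" where B: "B ** transpose B = S" using psd_factor[OF S] by blast
  show ?thesis
    unfolding dro_value_worst_case[OF \<rho> \<X> B]
  proof (rule antisym)
    show "(INF X\<in>\<X>. ereal (- ln (det X) + worst_case \<rho> X B)) \<le> Inf (?g ` ?P)"
    proof (rule INF_greatest, clarify)
      fix X \<gamma> assume h: "posdef (mat \<gamma> - X)" "posdef X" "X \<in> \<X>"
      have "worst_case \<rho> X B \<le> dual_bound \<rho> X S \<gamma>"
        using worst_case_le_dual_bound[OF h(2,1), of \<rho> B] \<rho> B by simp
      then show "(INF X\<in>\<X>. ereal (- ln (det X) + worst_case \<rho> X B)) \<le> ereal (- ln (det X) + dual_bound \<rho> X S \<gamma>)"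
        using h(3) by (intro INF_lower2[of X]) auto
    qed
    show "Inf (?g ` ?P) \<le> (INF X\<in>\<X>. ereal (- ln (det X) + worst_case \<rho> X B))"
    proof (rule INF_greatest, rule ereal_le_epsilon2)
      fix X and e :: real assume X: "X \<in> \<X>" and "0 < e"
      then have "posdef X" using \<X> by auto
      then obtain \<gamma> where "posdef (mat \<gamma> - X)" "dual_bound \<rho> X S \<gamma> \<le> worst_case \<rho> X B + e"
        using dual_bound_approx[OF _ \<rho> \<open>0 < e\<close>] B by metis
      then show "Inf (?g ` ?P) \<le> ereal (- ln (det X) + worst_case \<rho> X B) + ereal e"
        using X \<open>posdef X\<close> by (intro INF_lower2[of "(X, \<gamma>)"]) auto
    qed
  qed
qed

section \<open>Continuity of the optimal value\<close>

text \<open>Using the bound in both directions squeezes \<open>k y\<close> between \<open>k x / w\<close> and \<open>w k x\<close>.\<close>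

lemma continuous_on_multiplicative_modulus:
  fixes k :: "'a::metric_space \<Rightarrow> real"
  assumes w: "isCont w 0" "w 0 = 1" "\<And>d. 0 \<le> d \<Longrightarrow> 1 \<le> w d"
    and le: "\<And>x y. x \<in> A \<Longrightarrow> y \<in> A \<Longrightarrow> k x \<le> w (dist x y) * k y"
  shows "continuous_on A k"
  unfolding continuous_on_def
proof
  fix x assume x: "x \<in> A"
  have "((\<lambda>y. w (dist y x)) \<longlongrightarrow> w 0) (at x within A)"
    by (rule isCont_tendsto_compose[OF w(1)]) (rule tendsto_eq_intros | simp)+
  then have lim: "((\<lambda>y. w (dist y x)) \<longlongrightarrow> 1) (at x within A)" by (simp add: w)
  have in_A: "\<forall>\<^sub>F y in at x within A. y \<in> A" by (simp add: eventually_at_filter)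
  show "(k \<longlongrightarrow> k x) (at x within A)"
  proof (rule tendsto_sandwich)
    show "\<forall>\<^sub>F y in at x within A. k x / w (dist y x) \<le> k y"
      using in_A
    proof eventually_elim
      case (elim y)
      have "0 < w (dist y x)" using w(3)[of "dist y x"] by simp
      then show ?case using le[OF x elim] by (simp add: dist_commute divide_le_eq mult.commute)
    qed
    show "\<forall>\<^sub>F y in at x within A. k y \<le> w (dist y x) * k x"
      using in_A by eventually_elim (rule le[OF _ x])
    show "((\<lambda>y. k x / w (dist y x)) \<longlongrightarrow> k x) (at x within A)"
      using tendsto_divide[OF tendsto_const lim, of "k x"] by simp
    show "((\<lambda>y. w (dist y x) * k x) \<longlongrightarrow> k x) (at x within A)"
      using tendsto_mult[OF lim tendsto_const, of "k x"] by simp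
  qed
qed

lemma psd_shift_dominates:
  fixes S S' :: "real^'n^'n"
  assumes "psd S" "psd S'"
  shows "psd (S' + mat (dist S S') - S)"
  unfolding psd_def
proof (intro conjI allI)
  show "transpose (S' + mat (dist S S') - S) = S' + mat (dist S S') - S"
    using assms by (simp add: psd_def transpose_diff transpose_add)
  fix x
  show "0 \<le> x \<bullet> ((S' + mat (dist S S') - S) *v x)"
    using quadratic_form_le_norm[of x "S - S'"]
    by (simp add: matrix_vector_mult_diff_rdistrib matrix_vector_mult_add_rdistrib mat_mult_vec
        inner_diff_right inner_add_right dist_norm)
qed

text \<open>The factor \<open>(1 + \<delta> / r)\<^sup>2\<close> of \<open>worst_case_perturb\<close> with \<open>\<delta> = \<surd>(p d)\<close>, the distance
  of factors from \<open>psd_shifted_factors\<close>.\<close>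

definition covariance_modulus :: "nat \<Rightarrow> real \<Rightarrow> real \<Rightarrow> real" where
  "covariance_modulus p r d = (1 + sqrt (p * d) / r)\<^sup>2"

text \<open>Write \<open>S = B B\<^sup>T\<close> and \<open>S' = B' B'\<^sup>T\<close>, at distance \<open>d\<close>. As
  \<open>S \<preceq> S' + d I\<close>, the worst case for \<open>S\<close> is at most that for \<open>S' + d I\<close>, and the latter
  covariance and \<open>S'\<close> have factors at distance at most \<open>\<surd>(p d)\<close>.\<close>

lemma worst_case_covariance:
  fixes X B B' :: "real^'n^'n"
  assumes X: "posdef X" and r: "0 < r"
  shows "worst_case r X B \<le>
    covariance_modulus CARD('n) r (dist (B ** transpose B) (B' ** transpose B')) * worst_case r X B'"
proof -
  define d where "d = dist (B ** transpose B) (B' ** transpose B')"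
  have "0 \<le> d" by (simp add: d_def)
  then obtain D D' :: "real^'n^'n" where D: "D ** transpose D = B' ** transpose B'"
    "D' ** transpose D' = B' ** transpose B' + mat d" "(norm (D' - D))\<^sup>2 \<le> CARD('n) * d"
    using psd_shifted_factors[OF psd_gram] by metis
  have "norm (D' - D) \<le> sqrt (CARD('n) * d)" using D(3) by (rule real_le_rsqrt)
  then have "(1 + norm (D' - D) / r)\<^sup>2 \<le> covariance_modulus CARD('n) r d"
    using r unfolding covariance_modulus_def by (intro power_mono add_left_mono divide_right_mono) auto
  moreover have "worst_case r X B \<le> worst_case r X D'"
    by (rule worst_case_mono[OF X r]) (simp add: D d_def psd_shift_dominates psd_gram)
  moreover have "worst_case r X D' \<le> (1 + norm (D' - D) / r)\<^sup>2 * worst_case r X D"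
    by (rule worst_case_perturb[OF posdef_imp_psd[OF X] r])
  moreover have "worst_case r X D = worst_case r X B'" by (rule worst_case_cong[OF X r D(1)])
  ultimately show ?thesis
    using worst_case_pos[OF X r, of B'] mult_right_mono unfolding d_def by (smt (verit))
qed

text \<open>The objective plus the constant \<open>c\<close> is at least half the worst case, so a small relative
  change of the worst case is a small relative change of the shifted objective, uniformly in
  \<open>X\<close>. The infimum over \<open>X\<close> inherits it.\<close>

lemma continuous_on_dro_value:
  fixes \<X> :: "(real^'n^'n) set"
  assumes \<rho>: "0 < \<rho>" and \<X>: "\<X> \<subseteq> {X. posdef X}"
  shows "continuous_on {S. psd S} (dro_value \<rho> \<X>)"
proof (cases "\<X> = {}")
  case True
  then have "dro_value \<rho> \<X> = (\<lambda>_. \<top>)" by (auto simp: dro_value_def)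
  then show ?thesis by simp
next
  case False
  define fac where "fac S = (SOME B :: real^'n^'n. B ** transpose B = S)" for S
  have fac: "fac S ** transpose (fac S) = S" if "psd S" for S
    unfolding fac_def by (rule someI_ex) (use psd_factor[OF that] in metis)
  define c where "c = log_det_const CARD('n) \<rho>"
  define F where "F S X = - ln (det X) + worst_case \<rho> X (fac S) + c" for S X
  define k where "k S = (INF X\<in>\<X>. F S X)" for S
  have worst_le: "worst_case \<rho> X (fac S) \<le> 2 * F S X" if "X \<in> \<X>" for S X
    using ln_det_le_worst_case[OF _ \<rho>, of X "fac S"] \<X> that by (auto simp: F_def c_def)
  have F0: "0 \<le> F S X" if "X \<in> \<X>" for S X
    using worst_le[OF that, of S] worst_case_pos[OF _ \<rho>, of X "fac S"] \<X> that by force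
  have bdd: "bdd_below (F S ` \<X>)" for S by (rule bdd_belowI2[of _ 0]) (rule F0)
  have dro_eq: "dro_value \<rho> \<X> S = ereal (k S - c)" if "psd S" for S
  proof -
    have bdd': "bdd_below ((\<lambda>X. F S X - c) ` \<X>)" by (rule bdd_belowI2[of _ "- c"]) (use F0 in auto)
    have "k S - c = (INF X\<in>\<X>. F S X - c)"
    proof (rule antisym)
      show "k S - c \<le> (INF X\<in>\<X>. F S X - c)"
        using False cINF_lower[OF bdd] by (intro cINF_greatest) (auto simp: k_def)
      have "(INF X\<in>\<X>. F S X - c) + c \<le> k S"
        unfolding k_def using False cINF_lower[OF bdd'] by (intro cINF_greatest) (auto simp flip: le_diff_eq)
      then show "(INF X\<in>\<X>. F S X - c) \<le> k S - c" by simp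
    qed
    also have "ereal \<dots> = (INF X\<in>\<X>. ereal (F S X - c))"
      using ereal_Inf'[OF bdd'] False by (simp add: image_image)
    finally show ?thesis
      unfolding dro_value_worst_case[OF \<rho> \<X> fac[OF that]] by (simp add: F_def)
  qed
  define w where "w d = 2 * covariance_modulus CARD('n) \<rho> d - 1" for d
  have w1: "1 \<le> covariance_modulus CARD('n) \<rho> d" if "0 \<le> d" for d
    unfolding covariance_modulus_def using that \<rho> by (intro one_le_power) auto
  have "continuous_on {S. psd S} k"
  proof (rule continuous_on_multiplicative_modulus)
    show "isCont w 0" unfolding w_def covariance_modulus_def using \<rho> by (intro continuous_intros) auto
    show "w 0 = 1" by (simp add: w_def covariance_modulus_def)
    show "1 \<le> w d" if "0 \<le> d" for d using w1[OF that] by (simp add: w_def)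
    fix S S' :: "real^'n^'n" assume psd: "S \<in> {S. psd S}" "S' \<in> {S. psd S}"
    define m where "m = covariance_modulus CARD('n) \<rho> (dist S S')"
    have m: "1 \<le> m" unfolding m_def by (rule w1) simp
    have W: "w (dist S S') = 2 * m - 1" by (simp add: w_def m_def)
    have step: "k S \<le> (2 * m - 1) * F S' X" if X: "X \<in> \<X>" for X
    proof -
      have "k S \<le> F S X" unfolding k_def by (rule cINF_lower[OF bdd X])
      also have "\<dots> \<le> F S' X + (m - 1) * worst_case \<rho> X (fac S')"
        using worst_case_covariance[OF _ \<rho>, of X "fac S" "fac S'"] \<X> X psd fac
        by (auto simp: F_def m_def algebra_simps)
      also have "\<dots> \<le> F S' X + (m - 1) * (2 * F S' X)"
        using m worst_le[OF X] by (intro add_left_mono mult_left_mono) auto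
      also have "\<dots> = (2 * m - 1) * F S' X" by (simp add: algebra_simps)
      finally show ?thesis .
    qed
    have "k S / (2 * m - 1) \<le> k S'"
      unfolding k_def[of S'] using False m step
      by (intro cINF_greatest) (auto simp: divide_le_eq mult.commute)
    then show "k S \<le> w (dist S S') * k S'" using m by (simp add: W divide_le_eq mult.commute)
  qed
  then have "continuous_on {S. psd S} (\<lambda>S. ereal (k S - c))"
    by (intro continuous_on_ereal continuous_intros)
  then show ?thesis by (rule continuous_on_cong[THEN iffD1, rotated -1]) (auto simp: dro_eq)
qed

theorem theorem2p6:
  fixes \<rho> :: real and \<X> :: "(real^'n^'n) set"
  assumes "\<rho> > 0"
    and "\<X> \<subseteq> {X. posdef X}"
  shows "(\<forall>S. psd S \<longrightarrow>
           dro_value \<rho> \<X> S =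
             (INF (X, \<gamma>) \<in> {(X, \<gamma>). posdef (mat \<gamma> - X) \<and> posdef X \<and> X \<in> \<X>}.
                ereal (- ln (det X) + \<gamma> * (\<rho>\<^sup>2 - trace S)
                       + \<gamma>\<^sup>2 * mat_inner (matrix_inv (mat \<gamma> - X)) S)))
         \<and> continuous_on {S. psd S} (dro_value \<rho> \<X>)"
  using dro_value_dual[OF assms, unfolded dual_bound_def add.assoc[symmetric]]
    continuous_on_dro_value[OF assms] by blast

end
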